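(* Let $G$ and $H$ be finite abelian groups with $|G|=|H|=n$, and let $m$ be a positive integer with $m\ge n$. If $$|m\mathcal P_G\cap\mathbb Z^n|=|m\mathcal P_H\cap\mathbb Z^n|,$$ then $$|m\mathcal P_G^\circ\cap\mathbb Z^n|=|m\mathcal P_H^\circ\cap\mathbb Z^n|.$$ Moreover, for every $0\le k\le n-1$, one has $$\sum_{\substack{F\in\mathcal F(\mathcal P_G)\\ \dim F=k}}|mF^\circ\cap\mathbb Z^n|=\sum_{\substack{F\in\mathcal F(\mathcal P_H)\\ \dim F=k}}|mF^\circ\cap\mathbb Z^n|.$$
   Context: For a finite abelian group $G$ of order $n$ (written additively), let $\Delta_G=\{x=(x_g)_{g\in G}\in\mathbb R_{\ge0}^G:\sum_g x_g=1\}$ and let $\Lambda_G=\{(a_g)_{g\in G}\in\mathbb Z^G:\sum_g a_g g=0 \text{ in } G\}$, a full-rank sublattice of $\mathbb Z^G$. Choose a linear isomorphism $T:\mathbb R^G\to\mathbb R^n$ with $T(\Lambda_G)=\mathbb Z^n$; the zero-sum polytope of $G$ is $\mathcal P_G=T(\Delta_G)\subseteq\mathbb R^n$, a rational simplex of dimension $n-1$. (The choice of $T$ does not affect any of the lattice-point counts below.) $\mathcal F(\mathcal P)$ denotes the set of faces of a polytope $\mathcal P$ (including $\mathcal P$ itself), and $F^\circ$ denotes the relative interior of $F$. For a set $X\subseteq\mathbb R^n$, $mX=\{mx:x\in X\}$. *)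

theory Defs
  imports "HOL-Analysis.Analysis"
begin

text \<open>
  A finite abelian group \<open>G\<close> is a type of sort \<open>{ab_group_add, finite}\<close>, so that
  \<open>\<real>\<^sup>G\<close> is the type of vectors indexed by that type.
\<close>

text \<open>The integer multiple \<open>a g\<close>. At most one of the two sums is nonempty.\<close>

definition int_scale :: "int \<Rightarrow> 'g \<Rightarrow> 'g::ab_group_add" where
  "int_scale a g = (\<Sum>i<nat a. g) - (\<Sum>i<nat (- a). g)"

definition zero_sum_simplex :: "(real ^ 'g::finite) set" where
  "zero_sum_simplex = {x. (\<forall>g. 0 \<le> x $ g) \<and> (\<Sum>g\<in>UNIV. x $ g) = 1}"

definition zero_sum_lattice :: "(real ^ 'g::{ab_group_add, finite}) set" where
  "zero_sum_lattice =
    {(\<chi> g. of_int (a g)) | a :: 'g \<Rightarrow> int. (\<Sum>g\<in>UNIV. int_scale (a g) g) = 0}"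

definition integer_points :: "(real ^ 'n::finite) set" where
  "integer_points = {x. \<forall>i. x $ i \<in> \<int>}"

text \<open>
  The zero-sum polytope depends on the choice of a linear isomorphism carrying the zero-sum
  lattice onto the standard lattice. The choice is kept as a parameter \<open>T\<close>, so
  that statements can be made for every admissible \<open>T\<close>.
\<close>

definition lattice_iso ::
    "(real ^ 'g::{ab_group_add, finite} \<Rightarrow> real ^ 'n::finite) \<Rightarrow> bool" where
  "lattice_iso T \<longleftrightarrow> linear T \<and> bij T \<and> T ` zero_sum_lattice = integer_points"

definition zero_sum_polytope ::
    "(real ^ 'g::{ab_group_add, finite} \<Rightarrow> real ^ 'n::finite) \<Rightarrow> (real ^ 'n) set" where
  "zero_sum_polytope T = T ` zero_sum_simplex"

definition dilate :: "nat \<Rightarrow> (real ^ 'n::finite) set \<Rightarrow> (real ^ 'n) set" where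
  "dilate m X = (\<lambda>x. real m *\<^sub>R x) ` X"

end

theory Submission
  imports Defs "HOL-Algebra.Sylow"
begin

text \<open>
  A lattice point of \<open>m \<P>\<^sub>G\<close> is a multiset \<open>a\<close> of \<open>m\<close> elements of \<open>G\<close> with sum \<open>0\<close>, and the open face
  containing it is given by its support. Weight \<open>a\<close> by \<open>u\<close> to the size of its support. Taking
  the logarithmic derivative of the generating function in the group ring yields a recursion in
  \<open>m\<close>, which closes up once one counts, for every \<open>e\<close>, pairs of a multiset \<open>a\<close> and an element \<open>h\<close>
  with \<open>\<Sum> a + e h = 0\<close>. It follows without characters that \<open>n\<close> times the weighted number of zero-sum
  multisets is \<open>\<Sum> N(d) w\<^sub>d(u)\<close>, over the \<open>d\<close> dividing both \<open>n\<close> and \<open>m\<close>, where \<open>N(d)\<close> is the number of elements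
  of order \<open>d\<close> and \<open>w\<^sub>d\<close> depends on \<open>n\<close>, \<open>m\<close>, \<open>d\<close> only, with
  \<open>w\<^sub>d(1) = ((n + m) / d - 1) choose (m / d)\<close>.

  It remains to see that the value at \<open>u = 1\<close> determines all these \<open>N(d)\<close>. At the least \<open>d = q\<close> where
  they differ, \<open>q\<close> is a prime power, \<open>q\<^sup>2\<close> divides \<open>n\<close>, and the values differ by at least \<open>q\<close>. As
  \<open>q w\<^sub>q(1) \<ge> n w\<^sub>d(1)\<close> for every \<open>d > q\<close>, the terms with \<open>d > q\<close> cannot compensate this.
\<close>

section \<open>Multiples, torsion and zero-sum multisets\<close>

abbreviation nscale :: "nat \<Rightarrow> 'g \<Rightarrow> 'g::ab_group_add" where
  "nscale k g \<equiv> int_scale (int k) g"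

lemma int_scale_0 [simp]: "int_scale 0 g = 0"
  by (simp add: int_scale_def)

lemma int_scale_1 [simp]: "int_scale 1 g = g"
  by (simp add: int_scale_def)

lemma int_scale_zero_right [simp]: "int_scale a 0 = 0"
  by (simp add: int_scale_def)

lemma int_scale_Suc: "int_scale (a + 1) g = int_scale a g + g"
proof (cases "0 \<le> a")
  case True
  then have "nat (a + 1) = Suc (nat a)" "nat (- (a + 1)) = 0" "nat (- a) = 0" by auto
  then show ?thesis by (simp add: int_scale_def add.commute)
next
  case False
  then have "nat (- a) = Suc (nat (- (a + 1)))" "nat (a + 1) = 0" "nat a = 0" by auto
  then show ?thesis by (simp add: int_scale_def)
qed

lemma int_scale_add: "int_scale (a + b) g = int_scale a g + int_scale b g"
proof (induction b rule: int_induct[where k = 0])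
  case base
  then show ?case by simp
next
  case (step1 i)
  then show ?case using int_scale_Suc[of "a + i" g] int_scale_Suc[of i g]
    by (simp add: algebra_simps)
next
  case (step2 i)
  then show ?case using int_scale_Suc[of "a + i - 1" g] int_scale_Suc[of "i - 1" g]
    by (simp add: algebra_simps)
qed

lemma int_scale_minus: "int_scale (- a) g = - int_scale a g"
  using int_scale_add[of a "- a" g] by (simp add: eq_neg_iff_add_eq_0 add.commute)

lemma int_scale_diff: "int_scale (a - b) g = int_scale a g - int_scale b g"
  using int_scale_add[of a "- b" g] by (simp add: int_scale_minus)

lemma int_scale_add_right: "int_scale a (g + h) = int_scale a g + int_scale a h"
  by (simp add: int_scale_def sum.distrib)

lemma int_scale_minus_right: "int_scale a (- g) = - int_scale a g"
  using int_scale_add_right[of a g "- g"] by (simp add: eq_neg_iff_add_eq_0 add.commute)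

lemma int_scale_diff_right: "int_scale a (g - h) = int_scale a g - int_scale a h"
  using int_scale_add_right[of a g "- h"] by (simp add: int_scale_minus_right)

lemma int_scale_mult: "int_scale (a * b) g = int_scale a (int_scale b g)"
proof (induction a rule: int_induct[where k = 0])
  case base
  then show ?case by simp
next
  case (step1 i)
  then show ?case
    by (simp add: int_scale_add distrib_right)
next
  case (step2 i)
  then show ?case
    by (simp add: int_scale_diff left_diff_distrib)
qed

section \<open>Subgroups, element orders and torsion\<close>

definition add_subgroup :: "'g::ab_group_add set \<Rightarrow> bool" where
  "add_subgroup K \<longleftrightarrow> 0 \<in> K \<and> (\<forall>x\<in>K. \<forall>y\<in>K. x - y \<in> K)"

lemma add_subgroup_add:
  assumes "add_subgroup K" "x \<in> K" "y \<in> K"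
  shows "x + y \<in> K"
proof -
  have "0 - y \<in> K" using assms unfolding add_subgroup_def by blast
  then have "x - (0 - y) \<in> K" using assms unfolding add_subgroup_def by blast
  then show ?thesis by simp
qed

text \<open>Translation by \<open>h\<close> permutes \<open>K\<close>. Comparing the sum of all
  elements of \<open>K\<close> before and after it leaves \<open>card K\<close> copies of
  \<open>h\<close> with sum 0.\<close>

lemma nscale_card_subgroup:
  fixes K :: "'g::{ab_group_add,finite} set"
  assumes "add_subgroup K" "h \<in> K"
  shows "nscale (card K) h = 0"
proof -
  have "(\<Sum>g\<in>K. g + h) = (\<Sum>g\<in>K. g)"
    by (rule sum.reindex_bij_betw[where g = "\<lambda>x. x"], rule bij_betw_byWitness[where f' = "\<lambda>x. x - h"])
      (use assms in \<open>auto simp: add_subgroup_add add_subgroup_def\<close>)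
  then have "(\<Sum>g\<in>K. h) = 0" by (simp add: sum.distrib)
  moreover have "nscale (card A) h = (\<Sum>g\<in>A. h)" if "finite A" for A :: "'g set"
    using that by (induction A) (auto simp: int_scale_add add.commute)
  ultimately show ?thesis by simp
qed

lemma nscale_card_UNIV [simp]: "nscale (CARD('g)) (h :: 'g::{ab_group_add,finite}) = 0"
  by (rule nscale_card_subgroup) (auto simp: add_subgroup_def)

definition add_order :: "'g::ab_group_add \<Rightarrow> nat" where
  "add_order g = (LEAST k. 0 < k \<and> nscale k g = 0)"

lemma add_order_pos:
  fixes g :: "'g::{ab_group_add,finite}"
  shows "0 < add_order g" and nscale_add_order: "nscale (add_order g) g = 0"
proof -
  have "\<exists>k. 0 < k \<and> nscale k g = 0"
    by (rule exI[of _ "CARD('g)"]) simp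
  then have "0 < add_order g \<and> nscale (add_order g) g = 0"
    unfolding add_order_def by (rule LeastI_ex)
  then show "0 < add_order g" "nscale (add_order g) g = 0" by auto
qed

lemma nscale_eq_0_iff:
  fixes g :: "'g::{ab_group_add,finite}"
  shows "nscale k g = 0 \<longleftrightarrow> add_order g dvd k"
proof
  assume "add_order g dvd k"
  then obtain l where "k = l * add_order g" by (metis dvd_def mult.commute)
  then show "nscale k g = 0" by (simp add: int_scale_mult nscale_add_order)
next
  assume k: "nscale k g = 0"
  let ?d = "add_order g"
  have "int k = int (k div ?d) * int ?d + int (k mod ?d)"
    by (metis div_mult_mod_eq of_nat_add of_nat_mult)
  then have "nscale (k mod ?d) g = 0"
    using k by (simp only: int_scale_add int_scale_mult nscale_add_order) simp
  then have "k mod ?d = 0"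
    using not_less_Least[of "k mod ?d" "\<lambda>k. 0 < k \<and> nscale k g = 0"] add_order_pos(1)[of g]
    unfolding add_order_def[symmetric] by auto
  then show "?d dvd k" by auto
qed

definition torsion :: "nat \<Rightarrow> 'g::{ab_group_add,finite} set" where
  "torsion e = {h. nscale e h = 0}"

definition elements_of_order :: "nat \<Rightarrow> 'g::{ab_group_add,finite} set" where
  "elements_of_order d = {g. add_order g = d}"

lemma card_torsion:
  assumes "0 < e"
  shows "card (torsion e :: 'g::{ab_group_add,finite} set)
    = (\<Sum>d | d dvd e. card (elements_of_order d :: 'g set))"
proof -
  have "torsion e = (\<Union>d\<in>{d. d dvd e}. elements_of_order d :: 'g set)"
    by (auto simp: torsion_def elements_of_order_def nscale_eq_0_iff)
  moreover have "card \<dots> = (\<Sum>d | d dvd e. card (elements_of_order d :: 'g set))"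
    by (rule card_UN_disjoint) (use assms in \<open>auto simp: elements_of_order_def\<close>)
  ultimately show ?thesis by simp
qed

text \<open>A unimodular substitution turns \<open>(g, h)\<close> into \<open>(k, l)\<close> with
  \<open>j g + e h = gcd j e \<cdot> k\<close>.\<close>

lemma card_two_scales:
  fixes x :: "'g::{ab_group_add,finite}"
  assumes "0 < j"
  shows "card {(g, h). x + nscale j g + nscale e h = 0}
    = CARD('g) * card {k. x + nscale (gcd j e) k = 0}"
proof -
  obtain u v where uv: "u * int j + v * int e = gcd (int j) (int e)"
    using bezout_int by blast
  define d where "d = gcd (int j) (int e)"
  have uvd: "u * int j + v * int e = d" by (simp add: uv d_def)
  have "d > 0" using assms by (simp add: d_def)
  obtain j' where j': "int j = d * j'" by (metis d_def gcd_dvd1 dvdE)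
  obtain e' where e': "int e = d * e'" by (metis d_def gcd_dvd2 dvdE)
  have "d * (u * j' + v * e') = d * 1"
    using uvd by (simp add: j' e' algebra_simps)
  then have det: "u * j' + v * e' = 1" using \<open>d > 0\<close> by simp
  \<comment> \<open>The matrix of \<open>?P\<close> has rows \<open>(j', e')\<close> and
    \<open>(-v, u)\<close>, so by \<open>det\<close> its determinant is 1; \<open>?Q\<close> is its
    inverse. The second coordinate stays free and contributes the factor
    \<open>CARD('g)\<close>.\<close>
  let ?P = "\<lambda>(g, h). (int_scale j' g + int_scale e' h, int_scale u h - int_scale v g)"
  let ?Q = "\<lambda>(k, l). (int_scale u k - int_scale e' l, int_scale v k + int_scale j' l)"
  have one: "int_scale (u * j') g + int_scale (v * e') g = g" for g :: 'g
    by (simp flip: int_scale_add add: det)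
  have one': "int_scale (v * e') g + int_scale (u * j') g = g" for g :: 'g
    using one[of g] by (simp add: add.commute)
  have QP: "?Q (?P z) = z" for z :: "'g \<times> 'g"
    using one[of "fst z"] one[of "snd z"] 
    by (cases z) (simp add: int_scale_add_right int_scale_diff_right flip: int_scale_mult,
        simp add: algebra_simps)
  have PQ: "?P (?Q z) = z" for z :: "'g \<times> 'g"
    using one[of "fst z"] one[of "snd z"] 
    by (cases z) (simp add: int_scale_add_right int_scale_diff_right flip: int_scale_mult,
        simp add: algebra_simps)
  have comb: "nscale j g + nscale e h = int_scale d (fst (?P (g, h)))" for g h :: 'g
    by (simp add: int_scale_add_right j' e' int_scale_mult)
  have "bij_betw ?P {(g, h). x + nscale j g + nscale e h = 0}
      ({k. x + int_scale d k = 0} \<times> UNIV)"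
  proof (rule bij_betw_byWitness[where f' = ?Q])
    show "?P ` {(g, h). x + nscale j g + nscale e h = 0} \<subseteq> {k. x + int_scale d k = 0} \<times> UNIV"
      using comb by (auto simp: add.assoc)
    have "x + nscale j g + nscale e h = 0" if "x + int_scale d k = 0" "(g, h) = ?Q (k, l)" for g h k l
      using comb[of g h] that PQ[of "(k, l)"] by (simp add: add.assoc)
    then show "?Q ` ({k. x + int_scale d k = 0} \<times> UNIV) \<subseteq> {(g, h). x + nscale j g + nscale e h = 0}"
      by fast
  qed (use QP PQ in blast)+
  then have "card {(g, h). x + nscale j g + nscale e h = 0}
      = card ({k. x + int_scale d k = 0} \<times> (UNIV :: 'g set))"
    by (rule bij_betw_same_card)
  then show ?thesis by (simp add: card_cartesian_product d_def)
qed

section \<open>Multisets as multiplicity functions, weighted by support size\<close>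

definition compositions :: "nat \<Rightarrow> ('g::finite \<Rightarrow> nat) set" where
  "compositions m = {a. sum a UNIV = m}"

definition weighted_sum :: "('g \<Rightarrow> nat) \<Rightarrow> 'g::{ab_group_add,finite}" where
  "weighted_sum a = (\<Sum>g\<in>UNIV. nscale (a g) g)"

definition supp_card :: "('g::finite \<Rightarrow> nat) \<Rightarrow> nat" where
  "supp_card a = card {g. a g \<noteq> 0}"

lemma finite_compositions [simp]: "finite (compositions m :: ('g::finite \<Rightarrow> nat) set)"
proof -
  have "compositions m \<subseteq> (UNIV :: 'g set) \<rightarrow>\<^sub>E {..m}"
    by (auto simp: compositions_def PiE_def intro: member_le_sum)
  then show ?thesis by (rule finite_subset) (auto intro: finite_PiE)
qed

text \<open>The coefficient of \<open>t^k\<close> in \<open>(1 + (u - 1) t) / (1 - t)\<close>, the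
  factor that a single group element contributes to the generating function.\<close>

definition supp_wt :: "real \<Rightarrow> nat \<Rightarrow> real" where
  "supp_wt u k = (if k = 0 then 1 else u)"

lemma power_supp_card: "u ^ supp_card a = (\<Prod>g\<in>UNIV. supp_wt u (a g))"
proof -
  have "(\<Prod>g\<in>UNIV. supp_wt u (a g)) = (\<Prod>g | a g \<noteq> 0. u)"
    by (rule prod.mono_neutral_cong_right) (auto simp: supp_wt_def)
  then show ?thesis by (simp add: supp_card_def)
qed

text \<open>Coefficient form of the logarithmic derivative of \<open>(1 + (u - 1) t) / (1 - t)\<close>.\<close>

lemma supp_wt_recursion:
  "real k * supp_wt u k = (\<Sum>j=1..k. (1 - (1 - u) ^ j) * supp_wt u (k - j))"
proof (cases k)
  case 0
  then show ?thesis by simp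
next
  case (Suc l)
  have *: "(\<Sum>j=1..l. (1 - (1 - u) ^ j) * u) = real (Suc l) * u - 1 + (1 - u) ^ Suc l" for l
    by (induction l) (simp_all add: algebra_simps)
  \<comment> \<open>The term \<open>j = k\<close> is kept apart, since \<open>supp_wt u 0\<close> is
    1 and not \<open>u\<close>.\<close>
  have "(\<Sum>j=1..l. (1 - (1 - u) ^ j) * supp_wt u (k - j)) = (\<Sum>j=1..l. (1 - (1 - u) ^ j) * u)"
    by (rule sum.cong) (auto simp: supp_wt_def Suc)
  then show ?thesis using Suc * by (simp add: supp_wt_def)
qed

lemma weighted_sum_upd:
  "weighted_sum (a(g := a g + j)) = weighted_sum a + nscale j g"
proof -
  have "weighted_sum (a(g := a g + j))
      = (\<Sum>h\<in>UNIV. nscale (a h) h + (if h = g then nscale j h else 0))"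
    unfolding weighted_sum_def by (rule sum.cong) (auto simp: int_scale_add)
  then show ?thesis by (simp add: sum.distrib weighted_sum_def)
qed

lemma sum_upd_add: "sum (a(g := a g + j)) (UNIV :: 'g::finite set) = sum a UNIV + (j::nat)"
proof -
  have "sum (a(g := a g + j)) UNIV = (\<Sum>h\<in>UNIV. a h + (if h = g then j else 0))"
    by (rule sum.cong) auto
  then show ?thesis by (simp add: sum.distrib)
qed

text \<open>The weight is a product over group elements, and changing the multiplicity of
  \<open>g\<close> affects one factor only, to which \<open>supp_wt_recursion\<close>
  applies.\<close>

lemma power_supp_card_recursion:
  "real (a g) * u ^ supp_card a
    = (\<Sum>j=1..a g. (1 - (1 - u) ^ j) * u ^ supp_card (a(g := a g - j)))"
proof -
  define r where "r = (\<Prod>h\<in>UNIV - {g}. supp_wt u (a h))"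
  have "u ^ supp_card (a(g := l)) = supp_wt u l * r" for l
  proof -
    have "(\<Prod>h\<in>UNIV - {g}. supp_wt u ((a(g := l)) h)) = r"
      unfolding r_def by (rule prod.cong) auto
    then show ?thesis
      by (subst power_supp_card, subst prod.remove[of _ g]) auto
  qed
  \<comment> \<open>The second instance takes \<open>l = a g\<close>, where the update is trivial,
    and so rewrites \<open>u ^ supp_card a\<close> itself.\<close>
  note * = this this[of "a g", simplified]
  show ?thesis
    unfolding * by (simp add: supp_wt_recursion sum_distrib_right mult.assoc flip: mult.assoc[of "real (a g)"])
qed

text \<open>Write \<open>m\<close> as the sum of all \<open>a g\<close> and expand each term by
  \<open>power_supp_card_recursion\<close>. \<open>F\<close> is arbitrary so that it can later count
  the solutions \<open>h\<close> of an equation involving the weighted sum.\<close>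

lemma composition_recursion:
  fixes F :: "'g::{ab_group_add,finite} \<Rightarrow> real"
  shows "real m * (\<Sum>a\<in>compositions m. u ^ supp_card a * F (weighted_sum a))
    = (\<Sum>j=1..m. (1 - (1 - u) ^ j) *
        (\<Sum>g\<in>UNIV. \<Sum>a\<in>compositions (m - j). u ^ supp_card a * F (weighted_sum a + nscale j g)))"
proof -
  let ?c = "\<lambda>j. 1 - (1 - u) ^ j"
  have one: "(\<Sum>a\<in>compositions m. real (a g) * u ^ supp_card a * F (weighted_sum a))
      = (\<Sum>j=1..m. \<Sum>a\<in>compositions (m - j). ?c j * (u ^ supp_card a * F (weighted_sum a + nscale j g)))"
    (is "?L = ?R") for g
  proof -
    have "?L = (\<Sum>a\<in>compositions m. \<Sum>j\<in>{1..a g}. ?c j * u ^ supp_card (a(g := a g - j)) * F (weighted_sum a))"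
      by (simp only: power_supp_card_recursion sum_distrib_right)
    also have "\<dots> = (\<Sum>(a, j)\<in>Sigma (compositions m) (\<lambda>a. {1..a g}).
        ?c j * u ^ supp_card (a(g := a g - j)) * F (weighted_sum a))"
      by (rule sum.Sigma) auto
    also have "\<dots> = (\<Sum>(j, a)\<in>Sigma {1..m} (\<lambda>j. compositions (m - j)).
        ?c j * (u ^ supp_card a * F (weighted_sum a + nscale j g)))"
    \<comment> \<open>Removing \<open>j\<close> copies of \<open>g\<close> from \<open>a\<close>,
      and adding them back, are mutually inverse.\<close>
    proof (rule sum.reindex_bij_witness[where
          i = "\<lambda>(j, a). (a(g := a g + j), j)" and j = "\<lambda>(a, j). (j, a(g := a g - j))"], goal_cases)
      case (1 z)
      then show ?case by auto
    next
      case (2 z)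
      then obtain a j where z: "z = (a, j)" "sum a UNIV = m" "1 \<le> j" "j \<le> a g"
        by (auto simp: compositions_def)
      define b where "b = a(g := a g - j)"
      have ab: "a = b(g := b g + j)" using z by (auto simp: b_def)
      have "m = sum b UNIV + j" using sum_upd_add[of b g j] z ab by simp
      then show ?case using z by (auto simp: compositions_def b_def)
    next
      case (3 z)
      then show ?case by auto
    next
      case (4 z)
      then obtain j a where z: "z = (j, a)" "1 \<le> j" "j \<le> m" "sum a UNIV = m - j"
        by (auto simp: compositions_def)
      then have "sum (a(g := a g + j)) UNIV = m" using sum_upd_add[of a g j] by simp
      then show ?case using z by (auto simp: compositions_def)
    next
      case (5 z)
      then obtain a j where z: "z = (a, j)" "sum a UNIV = m" "1 \<le> j" "j \<le> a g"
        by (auto simp: compositions_def)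
      define b where "b = a(g := a g - j)"
      have ab: "a = b(g := b g + j)" using z by (auto simp: b_def)
      have "weighted_sum a = weighted_sum b + nscale j g" using weighted_sum_upd[of b g j] ab by simp
      then show ?case using z by (simp add: b_def)
    qed
    also have "\<dots> = ?R"
      by (rule sum.Sigma[symmetric]) auto
    finally show ?thesis .
  qed
  have "real m * (\<Sum>a\<in>compositions m. u ^ supp_card a * F (weighted_sum a))
      = (\<Sum>a\<in>compositions m. \<Sum>g\<in>UNIV. real (a g) * u ^ supp_card a * F (weighted_sum a))"
    by (auto simp: sum_distrib_left compositions_def sum_distrib_right mult.assoc intro!: sum.cong
        simp flip: sum_distrib_right)
  also have "\<dots> = (\<Sum>g\<in>UNIV. \<Sum>a\<in>compositions m. real (a g) * u ^ supp_card a * F (weighted_sum a))"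
    by (rule sum.swap)
  also have "\<dots> = (\<Sum>j=1..m. \<Sum>g\<in>UNIV. \<Sum>a\<in>compositions (m - j). ?c j * (u ^ supp_card a * F (weighted_sum a + nscale j g)))"
    unfolding one by (rule sum.swap)
  finally show ?thesis by (simp add: sum_distrib_left)
qed

text \<open>For \<open>d > 0\<close> this is the coefficient of \<open>t^m\<close> in
  \<open>((1 - (1 - u)^d t^d) / (1 - t^d))^(n/d)\<close>, computed through the logarithmic
  derivative. In terms of characters, this series is the product of the factors of all group
  elements twisted by a character of order \<open>d\<close>.\<close>

function torsion_weight :: "nat \<Rightarrow> real \<Rightarrow> nat \<Rightarrow> nat \<Rightarrow> real" where
  "torsion_weight n u d m = (if m = 0 then 1 else
     real n / real m *
       (\<Sum>j\<in>{j \<in> {1..m}. d dvd j}. (1 - (1 - u) ^ j) * torsion_weight n u d (m - j)))"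
  by auto
termination by (relation "Wellfounded.measure (\<lambda>(n, u, d, m). m)") auto

declare torsion_weight.simps [simp del]

lemma torsion_weight_0 [simp]: "torsion_weight n u d 0 = 1"
  by (subst torsion_weight.simps) simp

text \<open>Induction on \<open>m\<close> by \<open>composition_recursion\<close>. Since removing
  \<open>j\<close> copies of an element replaces \<open>e\<close> by \<open>gcd j e\<close>, the
  claim is needed for all \<open>e\<close> at once. For \<open>m = 0\<close> it is
  \<open>card_torsion\<close>.\<close>

lemma torsion_sum:
  fixes u :: real
  assumes "0 < e"
  shows "(\<Sum>a\<in>compositions m. u ^ supp_card a *
        real (card {h :: 'g::{ab_group_add,finite}. weighted_sum a + nscale e h = 0}))
    = (\<Sum>d | d dvd e \<and> d dvd m.
        real (card (elements_of_order d :: 'g set)) * torsion_weight (CARD('g)) u d m)"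
  using assms
proof (induction m arbitrary: e rule: less_induct)
  case (less m)
  let ?n = "CARD('g)"
  let ?c = "\<lambda>j. 1 - (1 - u) ^ j"
  let ?N = "\<lambda>d. real (card (elements_of_order d :: 'g set))"
  let ?F = "\<lambda>e x. real (card {h :: 'g. x + nscale e h = 0})"
  show ?case
  proof (cases "m = 0")
    case True
    have "(compositions 0 :: ('g \<Rightarrow> nat) set) = {\<lambda>_. 0}"
      by (auto simp: compositions_def)
    then show ?thesis
      using card_torsion[OF less.prems, where 'g = 'g]
      by (simp add: True weighted_sum_def supp_card_def torsion_def)
  next
    case False
    have fin: "finite {d. d dvd e \<and> d dvd m}" using less.prems by simp
    \<comment> \<open>Summing over \<open>g\<close> counts pairs \<open>(g, h)\<close>, which
      \<open>card_two_scales\<close> reduces to a single unknown.\<close>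
    have pairs: "(\<Sum>g\<in>UNIV. ?F e (x + nscale j g)) = real ?n * ?F (gcd j e) x"
      if "1 \<le> j" for j and x :: 'g
    proof -
      have "{(g, h). x + nscale j g + nscale e h = 0}
          = Sigma UNIV (\<lambda>g. {h. x + nscale j g + nscale e h = 0})" by auto
      then have "card {(g, h). x + nscale j g + nscale e h = 0}
          = (\<Sum>g\<in>UNIV. card {h. x + nscale j g + nscale e h = 0})" by simp
      then show ?thesis
        using card_two_scales[of j x e] that by (simp flip: of_nat_sum of_nat_mult)
    qed
    have "real m * (\<Sum>a\<in>compositions m. u ^ supp_card a * ?F e (weighted_sum a))
        = (\<Sum>j=1..m. ?c j * (\<Sum>a\<in>compositions (m - j). u ^ supp_card a *
            (\<Sum>g\<in>UNIV. ?F e (weighted_sum a + nscale j g))))"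
      unfolding composition_recursion[of m u "?F e"]
      by (subst sum.swap) (simp add: sum_distrib_left)
    also have "\<dots> = (\<Sum>j=1..m. ?c j * (real ?n *
        (\<Sum>a\<in>compositions (m - j). u ^ supp_card a * ?F (gcd j e) (weighted_sum a))))"
    proof (rule sum.cong)
      fix j assume "j \<in> {1..m}"
      then have "1 \<le> j" by simp
      have "(\<Sum>a\<in>compositions (m - j). u ^ supp_card a *
            (\<Sum>g\<in>UNIV. ?F e (weighted_sum a + nscale j g)))
          = (\<Sum>a\<in>compositions (m - j). real ?n * (u ^ supp_card a * ?F (gcd j e) (weighted_sum a)))"
        by (simp only: pairs[OF \<open>1 \<le> j\<close>] mult.left_commute)
      then show "?c j * (\<Sum>a\<in>compositions (m - j). u ^ supp_card a *
            (\<Sum>g\<in>UNIV. ?F e (weighted_sum a + nscale j g)))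
          = ?c j * (real ?n *
        (\<Sum>a\<in>compositions (m - j). u ^ supp_card a * ?F (gcd j e) (weighted_sum a)))"
        by (simp only: sum_distrib_left)
    qed simp
    also have "\<dots> = (\<Sum>j=1..m. \<Sum>d | d dvd e \<and> d dvd m.
        if d dvd j then ?N d * (real ?n * (?c j * torsion_weight ?n u d (m - j))) else 0)"
    proof (rule sum.cong)
      fix j assume j: "j \<in> {1..m}"
      \<comment> \<open>The range of \<open>d\<close> becomes a filter on a set independent of
        \<open>j\<close>, so that the two sums can be swapped and the inner one is the recursion of
        \<open>torsion_weight\<close>.\<close>
      have "{d. d dvd gcd j e \<and> d dvd m - j} = {d \<in> {d. d dvd e \<and> d dvd m}. d dvd j}"
        using j by (auto dest: dvd_diffD)
      then have "(\<Sum>a\<in>compositions (m - j). u ^ supp_card a * ?F (gcd j e) (weighted_sum a))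
          = (\<Sum>d\<in>{d \<in> {d. d dvd e \<and> d dvd m}. d dvd j}. ?N d * torsion_weight ?n u d (m - j))"
        using less.IH[of "m - j" "gcd j e"] j less.prems by auto
      then have *: "?c j * (real ?n * (\<Sum>a\<in>compositions (m - j). u ^ supp_card a * ?F (gcd j e) (weighted_sum a)))
          = (\<Sum>d\<in>{d \<in> {d. d dvd e \<and> d dvd m}. d dvd j}. ?N d * (real ?n * (?c j * torsion_weight ?n u d (m - j))))"
        by (simp add: sum_distrib_left mult_ac)
      show "?c j * (real ?n * (\<Sum>a\<in>compositions (m - j). u ^ supp_card a * ?F (gcd j e) (weighted_sum a)))
          = (\<Sum>d | d dvd e \<and> d dvd m.
        if d dvd j then ?N d * (real ?n * (?c j * torsion_weight ?n u d (m - j))) else 0)"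
        unfolding * by (rule sum.inter_filter[OF fin])
    qed simp
    also have "\<dots> = (\<Sum>d | d dvd e \<and> d dvd m. ?N d * (real m * torsion_weight ?n u d m))"
    proof (subst sum.swap, rule sum.cong)
      fix d
      have "real m * torsion_weight ?n u d m
          = real ?n * (\<Sum>j\<in>{j \<in> {1..m}. d dvd j}. ?c j * torsion_weight ?n u d (m - j))"
        using False by (subst torsion_weight.simps) simp
      then show "(\<Sum>j = 1..m. if d dvd j then ?N d * (real ?n * (?c j * torsion_weight ?n u d (m - j))) else 0)
          = ?N d * (real m * torsion_weight ?n u d m)"
        by (simp add: sum_distrib_left flip: sum.inter_filter)
    qed simp
    also have "\<dots> = real m * (\<Sum>d | d dvd e \<and> d dvd m. ?N d * torsion_weight ?n u d m)"
      by (simp add: sum_distrib_left mult_ac)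
    finally show ?thesis using False by simp
  qed
qed

text \<open>Take \<open>e = CARD('g)\<close> in \<open>torsion_sum\<close>: this \<open>e\<close>
  kills every \<open>h\<close>, so the number of solutions \<open>h\<close> is
  \<open>CARD('g)\<close> or 0 according to whether the weighted sum vanishes.\<close>

lemma zero_sum_weight:
  "real (CARD('g)) * (\<Sum>a | a \<in> compositions m \<and> weighted_sum a = (0 :: 'g::{ab_group_add,finite}). u ^ supp_card a)
    = (\<Sum>d | d dvd CARD('g) \<and> d dvd m.
        real (card (elements_of_order d :: 'g set)) * torsion_weight (CARD('g)) u d m)"
proof -
  have "(\<Sum>a\<in>compositions m. u ^ supp_card a *
        real (card {h :: 'g. weighted_sum a + nscale (CARD('g)) h = 0}))
     = (\<Sum>a\<in>compositions m. if weighted_sum a = (0::'g) then real (CARD('g)) * u ^ supp_card a else 0)"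
    by (rule sum.cong) auto
  also have "\<dots> = real (CARD('g)) * (\<Sum>a | a \<in> compositions m \<and> weighted_sum a = (0 :: 'g). u ^ supp_card a)"
    by (simp add: sum_distrib_left flip: sum.inter_filter)
  finally show ?thesis using torsion_sum[where e = "CARD('g)" and m = m and u = u and 'g = 'g] by simp
qed

text \<open>At \<open>u = 1\<close> all factors \<open>1 - (1 - u) ^ j\<close> with
  \<open>j \<ge> 1\<close> are 1. The recursion then becomes a hockey-stick sum followed by the
  absorption identity for binomials.\<close>

lemma torsion_weight_one:
  assumes "0 < a" "0 < d"
  shows "torsion_weight (d * a) 1 d (d * b) = real ((a + b - 1) choose b)"
proof (induction b rule: less_induct)
  case (less b)
  show ?case
  proof (cases b)
    case 0
    then show ?thesis by simp
  next
    case (Suc b')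
    obtain a' where a: "a = Suc a'" using assms by (cases a) auto
    have "(\<Sum>j\<in>{j \<in> {1..d * b}. d dvd j}. (1 - (1 - 1) ^ j) * torsion_weight (d * a) 1 d (d * b - j))
        = (\<Sum>k\<le>b'. real ((a' + k) choose k))"
    proof (rule sum.reindex_bij_witness[where i = "\<lambda>k. d * (b - k)" and j = "\<lambda>j. b - j div d"])
      fix j assume "j \<in> {j \<in> {1..d * b}. d dvd j}"
      then obtain i where i: "j = d * i" "1 \<le> i" "i \<le> b" using assms by (auto elim!: dvdE)
      then show "d * (b - (b - j div d)) = j" "b - j div d \<in> {..b'}" using assms Suc by auto
      have "torsion_weight (d * a) 1 d (d * (b - i)) = real ((a + (b - i) - 1) choose (b - i))"
        by (rule less.IH) (use i Suc in auto)
      then show "real ((a' + (b - j div d)) choose (b - j div d))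
          = (1 - (1 - 1) ^ j) * torsion_weight (d * a) 1 d (d * b - j)"
        using assms i by (simp add: a right_diff_distrib')
    next
      fix k assume "k \<in> {..b'}"
      then have "k < b" using Suc by auto
      then show "b - d * (b - k) div d = k" "d * (b - k) \<in> {j \<in> {1..d * b}. d dvd j}"
        using assms by auto
    qed
    also have "\<dots> = real (Suc (a' + b') choose b')"
      by (simp add: sum_choose_lower flip: of_nat_sum)
    finally have *: "(\<Sum>j\<in>{j \<in> {1..d * b}. d dvd j}. (1 - (1 - 1) ^ j) * torsion_weight (d * a) 1 d (d * b - j))
        = real (Suc (a' + b') choose b')" .
    have **: "torsion_weight (d * a) 1 d (d * b)
        = real a / real b * real (Suc (a' + b') choose b')"
    proof -
      have "real (d * a) / real (d * b) = real a / real b" using assms by simp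
      moreover have "d * b \<noteq> 0" using assms Suc by simp
      ultimately show ?thesis by (subst torsion_weight.simps) (simp only: * if_False)
    qed
    have "real b * real (Suc (a' + b') choose b) = real a * real (Suc (a' + b') choose b')"
      using Suc_times_binomial_add[of b' a'] unfolding Suc a
      by (simp only: add.commute[of a' b'] flip: of_nat_mult)
    then have "real a / real b * real (Suc (a' + b') choose b') = real (Suc (a' + b') choose b)"
      using Suc by (metis nonzero_mult_div_cancel_left of_nat_eq_0_iff nat.distinct(1) times_divide_eq_left)
    moreover have "a + b - 1 = Suc (a' + b')" using Suc a by simp
    ultimately show ?thesis unfolding ** by simp
  qed
qed

section \<open>A gap between binomial coefficients\<close>

text \<open>The product is a single term of Vandermonde's convolution.\<close>

lemma choose_mult_le:
  fixes r s x y :: nat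
  assumes "x \<le> r" 
  shows "(r choose x) * (s choose y) \<le> (r + s) choose (x + y)"
proof -
  have "(r choose x) * (s choose (x + y - x)) \<le> (\<Sum>k\<le>x + y. (r choose k) * (s choose (x + y - k)))"
    by (rule member_le_sum) auto
  then show ?thesis by (simp add: vandermonde)
qed

text \<open>With \<open>n = q * (q * c)\<close>, the number \<open>k\<close> is
  \<open>n/q - n/d\<close>. If \<open>d\<close> is at least \<open>2 q\<close>, then
  \<open>k\<close> is so large that \<open>2 k\<close> suffices as a bound. Otherwise the prime
  power \<open>q\<close> shares only a smaller power of \<open>p\<close> with \<open>d\<close>,
  which still makes \<open>k\<close> large enough for \<open>(2 * k) choose 2\<close>.\<close>

lemma central_binomial_ge:
  fixes p i q c d a k :: nat
  assumes "prime p" "q = p ^ i" "0 < c" "q < d" and n: "q * (q * c) = d * a" and k: "q * c = a + k"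
  shows "q * c \<le> (2 * k) choose k"
proof (cases "2 * q \<le> d")
  case True
  have "0 < q" using assms by (simp add: prime_gt_0_nat)
  have *: "2 * q * a \<le> d * a" using True by (rule mult_right_mono) simp
  have "q * (2 * a) \<le> q * (q * c)"
    unfolding n using * by (simp only: mult.left_commute[of q 2] mult.assoc)
  then have "2 * a \<le> q * c" using \<open>0 < q\<close> by simp
  then have "q * c \<le> 2 * k" using k by simp
  also have "\<dots> = (2 * k) choose 1" by simp
  also have "\<dots> \<le> (2 * k) choose k" by (rule binomial_maximum')
  finally show ?thesis .
next
  case False
  have "0 < q" using assms by (simp add: prime_gt_0_nat)
  have kd: "d * k = (d - q) * (q * c)"
    using n k by (simp add: diff_mult_distrib) (metis add_diff_cancel_left' distrib_left mult.assoc)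
  have kq: "q * k = (d - q) * a"
  proof -
    have "q * k + q * a = q * (q * c)" using k by (simp add: algebra_simps)
    then show ?thesis by (simp add: n diff_mult_distrib)
  qed
  have "0 < k" using kd assms \<open>0 < q\<close> by (cases "k = 0") auto
  \<comment> \<open>Since \<open>q < d < 2 q\<close>, \<open>q\<close> does not divide
    \<open>d\<close>, so \<open>g\<close> is a proper power \<open>p ^ j\<close> with
    \<open>j < i\<close>. The cofactor \<open>c'\<close> of \<open>d\<close> is then prime to
    \<open>p\<close> and must divide \<open>c\<close>.\<close>
  define g where "g = gcd q d"
  have "g > 0" using \<open>0 < q\<close> by (simp add: g_def)
  obtain j where j: "g = p ^ j" "j \<le> i"
    using divides_primepow_nat[OF assms(1), of g i] assms(2) by (auto simp: g_def)
  have "g \<noteq> q"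
  proof
    assume "g = q"
    then have "q dvd d" by (metis g_def gcd_dvd2)
    then obtain l where "d = q * l" ..
    then show False using assms(4) False by (cases l; cases "l - 1") auto
  qed
  then have "j < i" using j assms(2) by (cases "j = i") auto
  obtain c' where c': "d = g * c'" by (metis g_def gcd_dvd2 dvdE)
  have "\<not> p dvd c'"
  proof
    assume "p dvd c'"
    then have "p ^ Suc j dvd d" using c' j by (simp add: mult.commute mult_dvd_mono)
    moreover have "p ^ Suc j dvd q" using \<open>j < i\<close> assms(2) by (simp add: le_imp_power_dvd Suc_leI del: power_Suc)
    ultimately have "p ^ Suc j dvd p ^ j" using j(1) g_def by (metis gcd_greatest)
    then show False using assms(1) by (simp add: power_dvd_imp_le prime_gt_1_nat dvd_power_iff_le prime_ge_2_nat del: power_Suc)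
  qed
  then have "coprime p c'" using assms(1) by (rule prime_imp_coprime[rotated])
  then have "coprime c' q" using assms(2) by (simp add: coprime_commute)
  moreover have "c' dvd q * (q * c)" using n c' by simp
  ultimately have "c' dvd c" by (simp add: coprime_dvd_mult_right_iff)
  then obtain e where e: "c = c' * e" ..
  have "0 < e" "0 < c'" using e assms(3) by (auto intro: Nat.gr0I)
  have "g * a = q * (q * e)"
    using n \<open>0 < c'\<close> unfolding c' e by (simp add: mult_ac)
  \<comment> \<open>As \<open>g\<close> divides \<open>d - q\<close>, the identity \<open>kq\<close>
    gives \<open>q * k \<ge> g * a = q * (q * e)\<close>, hence \<open>k \<ge> q\<close>.\<close>
  have "g \<le> d - q"
    by (rule dvd_imp_le) (use assms(4) in \<open>auto simp: g_def\<close>)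
  then have "g * a \<le> q * k" unfolding kq by (rule mult_right_mono) simp
  then have "q * e \<le> k" using \<open>g * a = _\<close> \<open>0 < q\<close> by simp
  then have "q \<le> k" using \<open>0 < e\<close> by (metis One_nat_def Suc_leI dual_order.trans mult.right_neutral mult_le_mono2)
  have "1 * (q * c) \<le> d * k" unfolding kd using assms(4) by (intro mult_right_mono) auto
  then have "q * c \<le> d * k" by simp
  also have "\<dots> < 2 * q * k" using False \<open>0 < k\<close> by simp
  finally have "c < 2 * k" using \<open>0 < q\<close> by (simp add: mult.left_commute mult.assoc)
  then have "q * c \<le> k * (2 * k - 1)" using \<open>q \<le> k\<close> by (intro mult_mono) auto
  also have "\<dots> = (2 * k) choose 2" by (simp add: choose_two)
  also have "\<dots> \<le> (2 * k) choose k" by (rule binomial_maximum')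
  finally show ?thesis .
qed

text \<open>Put \<open>a = n/d\<close>, \<open>b = m/d\<close>, and let \<open>k\<close> and
  \<open>l\<close> be the increments from these to \<open>n/q\<close> and \<open>m/q\<close>. By
  \<open>choose_mult_le\<close> the binomial for \<open>q\<close> is at least the one for
  \<open>d\<close> times \<open>(k + l) choose l\<close>, and the latter factor is at least
  \<open>n/q\<close>.\<close>

lemma binomial_gap:
  fixes p i q c d n m :: nat
  assumes "prime p" "q = p ^ i" "q * q dvd n" "0 < n" "n \<le> m" "q < d"
    and "q dvd m" "d dvd n" "d dvd m"
  shows "n * ((n div d + m div d - 1) choose (m div d))
    \<le> q * ((n div q + m div q - 1) choose (m div q))"
proof -
  have "0 < q" using assms by (simp add: prime_gt_0_nat)
  obtain c where c: "n = q * (q * c)" using assms(3) by (metis dvdE mult.assoc)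
  obtain a where a: "n = d * a" using assms(8) ..
  obtain b where b: "m = d * b" using assms(9) ..
  obtain b' where b': "m = q * b'" using assms(7) ..
  have pos: "0 < c" "0 < a" using c a assms(4) by (auto intro: Nat.gr0I)
  have "a \<le> b" using assms(4,5) a b by simp
  have "q * a \<le> q * (q * c)" using c a assms(6) by (metis mult_le_mono1 less_imp_le)
  then have "a \<le> q * c" using \<open>0 < q\<close> by simp
  then obtain k where k: "q * c = a + k" by (auto simp: le_iff_add)
  have "q * b \<le> q * b'" using b b' assms(6) by (metis mult_le_mono1 less_imp_le)
  then have "b \<le> b'" using \<open>0 < q\<close> by simp
  then obtain l where l: "b' = b + l" by (auto simp: le_iff_add)
  have "q * k + q * a = d * a" using k c a by (metis add.commute distrib_left)
  then have qk: "q * k = (d - q) * a" by (simp add: diff_mult_distrib)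
  have "q * l + q * b = d * b" using l b b' by (metis add.commute distrib_left)
  then have ql: "q * l = (d - q) * b" by (simp add: diff_mult_distrib)
  \<comment> \<open>Here \<open>n \<le> m\<close> enters, through \<open>a \<le> b\<close>; it
    allows passing from the central binomial \<open>(2 * k) choose k\<close> to
    \<open>(k + l) choose k\<close>.\<close>
  have "q * k \<le> q * l" unfolding qk ql using \<open>a \<le> b\<close> by simp
  then have "k \<le> l" using \<open>0 < q\<close> by simp
  have "q * c \<le> (2 * k) choose k"
    by (rule central_binomial_ge[OF assms(1,2) pos(1) assms(6) _ k]) (use c a in simp)
  also have "\<dots> \<le> (k + l) choose k" using \<open>k \<le> l\<close> by (intro binomial_right_mono) simp
  also have "\<dots> = (k + l) choose l" using binomial_symmetric[of k "k + l"] by simp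
  finally have "((a + b - 1) choose b) * (q * c) \<le> ((a + b - 1) choose b) * ((k + l) choose l)"
    by simp
  also have "\<dots> \<le> (a + b - 1 + (k + l)) choose (b + l)"
    by (rule choose_mult_le) (use pos in simp)
  also have "a + b - 1 + (k + l) = q * c + b' - 1" using k l pos by simp
  finally have "((a + b - 1) choose b) * (q * c) \<le> (q * c + b' - 1) choose b'" by (simp only: l)
  then have "q * (((a + b - 1) choose b) * (q * c)) \<le> q * ((q * c + b' - 1) choose b')"
    by simp
  moreover have "n div d = a" "m div d = b" using a b assms(6) by simp_all
  moreover have "m div q = b'" "n div q = q * c" using b' c \<open>0 < q\<close> by simp_all
  ultimately show ?thesis using c by (simp add: mult_ac)
qed

section \<open>Comparing element orders of two groups\<close>

lemma add_subgroup_torsion: "add_subgroup (torsion e)"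
  by (simp add: add_subgroup_def torsion_def int_scale_diff_right)

text \<open>Cauchy's theorem from Sylow's with exponent 1: a subgroup of order \<open>p\<close> has
  a nonzero element, and \<open>p\<close> kills it by \<open>nscale_card_subgroup\<close>.\<close>

lemma cauchy_add_subgroup:
  fixes K :: "'g::{ab_group_add,finite} set"
  assumes K: "add_subgroup K" and p: "prime p" "p dvd card K"
  shows "\<exists>x\<in>K. x \<noteq> 0 \<and> nscale p x = 0"
proof -
  let ?G = "\<lparr>carrier = K, mult = (+), one = (0::'g)\<rparr>"
  have neg: "- x \<in> K" if "x \<in> K" for x
    using K that unfolding add_subgroup_def by (metis diff_0)
  have G: "group ?G"
  proof (rule groupI)
    fix x assume "x \<in> carrier ?G"
    then show "\<exists>y\<in>carrier ?G. y \<otimes>\<^bsub>?G\<^esub> x = \<one>\<^bsub>?G\<^esub>"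
      by (intro bexI[of _ "- x"]) (use neg in auto)
  qed (use K in \<open>auto simp: add_subgroup_add add.assoc add_subgroup_def\<close>)
  obtain k where "card K = p * k" using p(2) ..
  then have "order ?G = p ^ 1 * k" by (simp add: order_def)
  then obtain H where H: "subgroup H ?G" "card H = p ^ 1"
    using sylow_thm[OF p(1) G, of 1 k] by auto
  have "add_subgroup H"
    unfolding add_subgroup_def
  proof (intro conjI ballI)
    show "0 \<in> H" using subgroup.one_closed[OF H(1)] by simp
    fix x y assume xy: "x \<in> H" "y \<in> H"
    have "inv\<^bsub>?G\<^esub> y = - y"
      by (rule group.inv_equality[OF G]) (use xy subgroup.subset[OF H(1)] neg in auto)
    then show "x - y \<in> H"
      using subgroup.m_closed[OF H(1) xy(1) subgroup.m_inv_closed[OF H(1) xy(2)]] by simp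
  qed
  then have "nscale p x = 0" if "x \<in> H" for x
    using nscale_card_subgroup[of H x] that H(2) by simp
  moreover have "\<not> H \<subseteq> {0}"
    using card_mono[of "{0}" H] H(2) prime_gt_1_nat[OF p(1)] by auto
  ultimately show ?thesis using subgroup.subset[OF H(1)] by fastforce
qed

text \<open>Every nonempty fibre of \<open>f\<close> on \<open>K\<close> is a translate of the
  kernel.\<close>

lemma card_additive_image:
  fixes K :: "'g::{ab_group_add,finite} set" and f :: "'g \<Rightarrow> 'a::ab_group_add"
  assumes K: "add_subgroup K" and f: "\<And>x y. f (x - y) = f x - f y"
  shows "card K = card (f ` K) * card {x \<in> K. f x = 0}"
proof -
  have "card K = (\<Sum>y\<in>f ` K. card {x \<in> K. f x = y})"
    using sum.image_gen[of K "\<lambda>_. 1::nat" f] by simp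
  also have "\<dots> = (\<Sum>y\<in>f ` K. card {x \<in> K. f x = 0})"
  proof (rule sum.cong)
    fix y assume "y \<in> f ` K"
    then obtain z where z: "z \<in> K" "f z = y" by auto
    have f_add: "f (x + z) = f x + y" for x
      using f[of "x + z" z] z(2) by (simp add: algebra_simps)
    have "bij_betw (\<lambda>x. x - z) {x \<in> K. f x = y} {x \<in> K. f x = 0}"
      by (rule bij_betw_byWitness[where f' = "\<lambda>x. x + z"])
        (use z K in \<open>auto simp: f f_add add_subgroup_add add_subgroup_def\<close>)
    then show "card {x \<in> K. f x = y} = card {x \<in> K. f x = 0}" by (rule bij_betw_same_card)
  qed simp
  finally show ?thesis by simp
qed

lemma card_range_nscale:
  "CARD('g::{ab_group_add,finite}) = card (range (nscale e :: 'g \<Rightarrow> 'g)) * card (torsion e :: 'g set)"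
  using card_additive_image[of UNIV "nscale e :: 'g \<Rightarrow> 'g"]
  by (simp add: add_subgroup_def int_scale_diff_right torsion_def)

lemma torsion_gt_0: "0 < card (torsion e)"
  by (auto simp: card_gt_0_iff torsion_def intro: exI[of _ 0])

text \<open>Multiplication by \<open>a\<close> maps \<open>torsion (a * b)\<close> onto
  \<open>torsion b\<close> with kernel \<open>torsion a\<close>. For surjectivity, Bezout gives
  \<open>y = a (u y)\<close> on \<open>torsion b\<close>.\<close>

lemma card_torsion_coprime:
  assumes "coprime a b"
  shows "card (torsion (a * b) :: 'g::{ab_group_add,finite} set)
    = card (torsion a :: 'g set) * card (torsion b :: 'g set)"
proof -
  have "nscale a ` torsion (a * b) = (torsion b :: 'g set)"
  proof (intro equalityI subsetI)
    fix y :: 'g assume "y \<in> nscale a ` torsion (a * b)"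
    then show "y \<in> torsion b"
      by (auto simp: torsion_def simp flip: int_scale_mult) (simp add: mult.commute)
  next
    fix y :: 'g assume y: "y \<in> torsion b"
    obtain u v where uv: "u * int a + v * int b = 1"
      using bezout_int[of "int a" "int b"] assms by auto
    have "y = int_scale (u * int a + v * int b) y" by (simp add: uv)
    also have "\<dots> = int_scale (int a * u) y"
      using y by (simp add: int_scale_add int_scale_mult[of v] torsion_def mult.commute[of u])
    finally have "y = nscale a (int_scale u y)" by (simp add: int_scale_mult)
    moreover have "nscale (a * b) (int_scale u y) = int_scale (int a * u) (nscale b y)"
      by (simp add: mult_ac flip: int_scale_mult)
    then have "int_scale u y \<in> torsion (a * b)" using y by (simp add: torsion_def)
    ultimately show "y \<in> nscale a ` torsion (a * b)" by blast
  qed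
  moreover have "{x \<in> torsion (a * b). nscale a x = 0} = (torsion a :: 'g set)"
    by (auto simp: torsion_def int_scale_mult mult.commute[of "int a"])
  ultimately show ?thesis
    using card_additive_image[OF add_subgroup_torsion[of "a * b"], of "nscale a :: 'g \<Rightarrow> 'g"]
    by (simp add: int_scale_diff_right)
qed

text \<open>The \<open>p\<close>-torsion of \<open>p^j G\<close>. For prime \<open>p\<close> its
  order is \<open>p\<close> to the number of cyclic factors of order at least \<open>p^(j+1)\<close>
  in the \<open>p\<close>-part of \<open>G\<close>.\<close>

definition socle_layer :: "nat \<Rightarrow> nat \<Rightarrow> 'g::{ab_group_add,finite} set" where
  "socle_layer p j = {y \<in> range (nscale (p ^ j)). nscale p y = 0}"

lemma add_subgroup_range_nscale: "add_subgroup (range (nscale e))"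
  unfolding add_subgroup_def
  by (auto simp flip: int_scale_diff_right) (metis int_scale_zero_right rangeI)

lemma add_subgroup_socle_layer: "add_subgroup (socle_layer p j :: 'a::{ab_group_add,finite} set)"
proof -
  have "x - y \<in> socle_layer p j" if "x \<in> socle_layer p j" "y \<in> socle_layer p j" for x y :: 'a
    using that add_subgroup_range_nscale[of "p ^ j", where 'a = 'a]
    unfolding add_subgroup_def socle_layer_def mem_Collect_eq int_scale_diff_right by auto
  moreover have "(0::'a) \<in> socle_layer p j"
    using add_subgroup_range_nscale[of "p ^ j", where 'a = 'a]
    unfolding add_subgroup_def socle_layer_def by simp
  ultimately show ?thesis by (simp add: add_subgroup_def)
qed

text \<open>Multiplication by \<open>p ^ j\<close> maps \<open>torsion (p ^ Suc j)\<close> onto the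
  layer, with kernel \<open>torsion (p ^ j)\<close>.\<close>

lemma card_torsion_power_Suc:
  "card (torsion (p ^ Suc j) :: 'g::{ab_group_add,finite} set)
    = card (torsion (p ^ j) :: 'g set) * card (socle_layer p j :: 'g set)"
proof -
  have *: "nscale (p ^ Suc j) x = nscale p (nscale (p ^ j) x)" for x :: 'g
    by (simp flip: int_scale_mult)
  have "nscale (p ^ j) ` torsion (p ^ Suc j) = (socle_layer p j :: 'g set)"
    by (auto simp: torsion_def socle_layer_def * simp del: power_Suc of_nat_power)
  moreover have "{x \<in> torsion (p ^ Suc j). nscale (p ^ j) x = 0} = (torsion (p ^ j) :: 'g set)"
    by (auto simp: torsion_def * simp del: power_Suc of_nat_power)
  ultimately show ?thesis
    using card_additive_image[OF add_subgroup_torsion[of "p ^ Suc j"], of "nscale (p ^ j) :: 'g \<Rightarrow> 'g"]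
    by (simp only: int_scale_diff_right mult.commute)
qed

lemma socle_layer_antimono:
  assumes "i \<le> j"
  shows "socle_layer p j \<subseteq> socle_layer p i"
proof -
  have "nscale (p ^ j) x = nscale (p ^ i) (nscale (p ^ (j - i)) x)" for x
    using assms by (simp flip: int_scale_mult power_add)
  then show ?thesis by (auto simp: socle_layer_def)
qed

lemma card_socle_layer_mono:
  "i \<le> j \<Longrightarrow> card (socle_layer p j :: 'g::{ab_group_add,finite} set) \<le> card (socle_layer p i :: 'g set)"
  by (intro card_mono socle_layer_antimono) auto

text \<open>A prime \<open>l\<close> dividing the order yields, by Cauchy, a nonzero element killed
  by both \<open>l\<close> and \<open>p\<close>, so \<open>l = p\<close>.\<close>

lemma card_socle_layer_power:
  assumes "prime p"
  shows "\<exists>r. card (socle_layer p j :: 'g::{ab_group_add,finite} set) = p ^ r"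
proof -
  let ?K = "socle_layer p j :: 'g set"
  have "0 \<in> ?K" using add_subgroup_socle_layer[of p j] by (auto simp: add_subgroup_def)
  then have "card ?K \<noteq> 0" by auto
  then obtain k where k: "card ?K = p ^ multiplicity p (card ?K) * k" "\<not> p dvd k"
    using multiplicity_decompose'[of "card ?K" p] assms by (metis not_prime_unit)
  have "k = 1"
  proof (rule ccontr)
    assume "k \<noteq> 1"
    then obtain l where l: "prime l" "l dvd k" using prime_factor_nat by blast
    then have "l dvd card ?K" using k(1) by (metis dvd_mult)
    then obtain x where x: "x \<in> ?K" "x \<noteq> 0" "nscale l x = 0"
      using cauchy_add_subgroup[OF add_subgroup_socle_layer l(1)] by blast
    then have "add_order x dvd l" "add_order x dvd p"
      by (auto simp: nscale_eq_0_iff socle_layer_def)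
    moreover have "add_order x \<noteq> 1" using x(2) nscale_add_order[of x] by auto
    ultimately have "l = p" using assms l(1) by (metis prime_nat_iff)
    then show False using l(2) k(2) by simp
  qed
  then show ?thesis using k(1) by auto
qed

text \<open>Both torsion orders at \<open>q\<close> are the common order \<open>t\<close> times a
  layer, \<open>p ^ r\<close> against \<open>p ^ s\<close> with \<open>s < r\<close>. Equality of
  the group orders forces \<open>s \<ge> 1\<close>, hence \<open>r \<ge> 2\<close>, and the earlier
  layers are at least as large.\<close>

lemma first_torsion_difference:
  fixes p i q :: nat
  assumes card: "CARD('g::{ab_group_add,finite}) = CARD('h::{ab_group_add,finite})"
    and p: "prime p" and q: "q = p ^ Suc i"
    and eq: "card (torsion (p ^ i) :: 'g set) = card (torsion (p ^ i) :: 'h set)"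
    and less: "card (torsion q :: 'h set) < card (torsion q :: 'g set)"
  shows "q * q dvd CARD('g)" "card (torsion q :: 'h set) + q \<le> card (torsion q :: 'g set)"
proof -
  define t where "t = card (torsion (p ^ i) :: 'h set)"
  let ?R = "\<lambda>j. card (socle_layer p j :: 'g set)"
  let ?S = "\<lambda>j. card (socle_layer p j :: 'h set)"
  have p2: "2 \<le> p" using p by (rule prime_ge_2_nat)
  have tG: "card (torsion q :: 'g set) = t * ?R i"
    unfolding q card_torsion_power_Suc by (simp add: eq t_def)
  have tH: "card (torsion q :: 'h set) = t * ?S i"
    unfolding q card_torsion_power_Suc by (simp add: t_def)
  have "?S i < ?R i" using less tG tH by simp
  obtain r where r: "?R i = p ^ r" using card_socle_layer_power[OF p] by blast
  obtain s where s: "?S i = p ^ s" using card_socle_layer_power[OF p] by blast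
  have "s < r" using \<open>?S i < ?R i\<close> p2 unfolding r s by simp
  then have "p dvd ?R i" unfolding r by simp
  \<comment> \<open>The factor \<open>p\<close> of the larger layer must divide the order of
    \<open>p^i H\<close> too, so Cauchy gives a nonzero element in the layer of
    \<open>'h\<close>.\<close>
  have "t * ?R i dvd CARD('h)"
    using card_range_nscale[where e = q and 'g = 'g] tG card by (metis dvd_triv_right)
  moreover have "CARD('h) = t * card (range (nscale (p ^ i) :: 'h \<Rightarrow> 'h))"
    using card_range_nscale[where e = "p ^ i" and 'g = 'h] by (simp add: t_def)
  moreover have "0 < t" unfolding t_def by (rule torsion_gt_0)
  ultimately have "?R i dvd card (range (nscale (p ^ i) :: 'h \<Rightarrow> 'h))" by simp
  then have "p dvd card (range (nscale (p ^ i) :: 'h \<Rightarrow> 'h))"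
    using \<open>p dvd ?R i\<close> by (rule dvd_trans[rotated])
  then obtain x :: 'h where "x \<in> socle_layer p i" "x \<noteq> 0"
    using cauchy_add_subgroup[OF add_subgroup_range_nscale p] unfolding socle_layer_def by blast
  moreover have "(0::'h) \<in> socle_layer p i"
    using add_subgroup_socle_layer by (auto simp: add_subgroup_def)
  ultimately have "card {0, x} \<le> ?S i" by (intro card_mono) auto
  then have "?S i \<noteq> 1" using \<open>x \<noteq> 0\<close> by simp
  then have "1 \<le> s" using s by (cases s) auto
  \<comment> \<open>Each layer of \<open>'g\<close> up to index \<open>i\<close> contributes a
    factor \<open>p ^ 2\<close>; at \<open>j = Suc i\<close> this gives
    \<open>q * q\<close>.\<close>
  have "p ^ (2 * j) dvd card (torsion (p ^ j) :: 'g set)" if "j \<le> Suc i" for j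
    using that
  proof (induction j)
    case (Suc j)
    obtain r' where r': "?R j = p ^ r'" using card_socle_layer_power[OF p] by blast
    have "p ^ r \<le> p ^ r'"
      using card_socle_layer_mono[of j i p, where 'g = 'g] Suc.prems by (simp add: r r')
    then have "2 \<le> r'" using p2 \<open>1 \<le> s\<close> \<open>s < r\<close> by simp
    then have "p ^ 2 dvd ?R j" unfolding r' by (rule le_imp_power_dvd)
    with Suc have "p ^ (2 * j) * p ^ 2 dvd card (torsion (p ^ j) :: 'g set) * ?R j"
      by (intro mult_dvd_mono) auto
    moreover have "p ^ (2 * Suc j) = p ^ (2 * j) * p ^ 2"
      by (simp add: power2_eq_square)
    ultimately show ?case by (simp only: card_torsion_power_Suc)
  qed simp
  from this[of "Suc i"] have "q * q dvd card (torsion q :: 'g set)"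
    by (simp only: q power2_eq_square mult.commute[of 2] power_mult order_refl)
  then show "q * q dvd CARD('g)"
    using card_range_nscale[where e = q and 'g = 'g] by (metis dvd_mult)
  have "p ^ j \<le> card (torsion (p ^ j) :: 'h set)" if "j \<le> Suc i" for j
    using that
  proof (induction j)
    case 0
    then show ?case using torsion_gt_0[of 1, where 'a = 'h] by simp
  next
    case (Suc j)
    have "p \<le> ?S i" using \<open>1 \<le> s\<close> p2 unfolding s by (metis power_increasing power_one_right one_le_numeral order_trans)
    also have "\<dots> \<le> ?S j" using Suc.prems by (intro card_socle_layer_mono) simp
    finally have "p ^ j * p \<le> card (torsion (p ^ j) :: 'h set) * ?S j"
      using Suc by (intro mult_mono) auto
    then show ?case unfolding card_torsion_power_Suc by (simp add: mult.commute)
  qed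
  then have "p ^ i \<le> t" by (simp add: t_def)
  have "p \<le> p ^ s" using \<open>1 \<le> s\<close> p2 by (metis power_increasing power_one_right one_le_numeral order_trans)
  then have "p ^ i * p \<le> t * p ^ s" using \<open>p ^ i \<le> t\<close> by (intro mult_mono) auto
  \<comment> \<open>Since \<open>q \<le> t * p ^ s\<close>, adding \<open>q\<close> at most doubles
    the smaller order, while the larger is at least \<open>p \<ge> 2\<close> times it.\<close>
  then have "t * p ^ s + q \<le> t * p ^ s * 2" by (simp add: q mult.commute)
  also have "\<dots> \<le> t * p ^ s * p" using p2 by (intro mult_mono) auto
  also have "\<dots> = t * p ^ Suc s" by simp
  also have "\<dots> \<le> t * p ^ r" using \<open>s < r\<close> p2 by (intro mult_left_mono power_increasing) auto
  finally show "card (torsion q :: 'h set) + q \<le> card (torsion q :: 'g set)"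
    using r s tG tH by simp
qed

section \<open>Recovering the element counts from the number of zero-sum multisets\<close>

lemma card_elements_of_order_1 [simp]: "card (elements_of_order (Suc 0) :: 'g::{ab_group_add,finite} set) = 1"
proof -
  have "elements_of_order 1 = {0::'g}"
    using nscale_eq_0_iff[of 1, where 'g = 'g] by (auto simp: elements_of_order_def)
  then show ?thesis by simp
qed

text \<open>The excess of \<open>'g\<close> at the least differing order \<open>q\<close> is worth
  at least \<open>q\<close> times the binomial at \<open>q\<close>. All terms of \<open>'h\<close>
  beyond \<open>q\<close> together stay below that.\<close>

lemma no_first_difference:
  fixes m n q :: nat
  assumes card: "CARD('g::{ab_group_add,finite}) = n" "CARD('h::{ab_group_add,finite}) = n"
    and "n \<le> m"
    and q: "q dvd n" "q dvd m"
    and eq: "\<And>d. \<lbrakk>d < q; d dvd n; d dvd m\<rbrakk>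
      \<Longrightarrow> card (elements_of_order d :: 'g set) = card (elements_of_order d :: 'h set)"
    and less: "card (elements_of_order q :: 'h set) < card (elements_of_order q :: 'g set)"
    and sums: "(\<Sum>d | d dvd n \<and> d dvd m. card (elements_of_order d :: 'g set) * ((n div d + m div d - 1) choose (m div d)))
      = (\<Sum>d | d dvd n \<and> d dvd m. card (elements_of_order d :: 'h set) * ((n div d + m div d - 1) choose (m div d)))"
  shows False
proof -
  let ?N = "\<lambda>d. card (elements_of_order d :: 'g set)" and ?M = "\<lambda>d. card (elements_of_order d :: 'h set)"
  define W where "W d = (n div d + m div d - 1) choose (m div d)" for d
  have "0 < n" unfolding card(1)[symmetric] by simp
  have "0 < q" using q(1) \<open>0 < n\<close> by (rule dvd_pos_nat[rotated])
  have tors_eq: "card (torsion e :: 'g set) = card (torsion e :: 'h set)" if "e dvd q" "e < q" for e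
  proof -
    have "0 < e" using that(1) \<open>0 < q\<close> by (rule dvd_pos_nat[rotated])
    then show ?thesis unfolding card_torsion[OF \<open>0 < e\<close>]
      by (intro sum.cong refl eq) (use that q in \<open>auto dest: dvd_imp_le intro: dvd_trans\<close>)
  qed
  have "{d. d dvd q} = insert q {d. d dvd q \<and> d < q}"
    using \<open>0 < q\<close> by (auto dest: dvd_imp_le)
  moreover have "(\<Sum>d | d dvd q \<and> d < q. ?N d) = (\<Sum>d | d dvd q \<and> d < q. ?M d)"
    by (intro sum.cong refl eq) (use q in \<open>auto intro: dvd_trans\<close>)
  \<comment> \<open>\<open>c\<close> collects the proper divisors of \<open>q\<close>, where both
    groups agree, so the torsion orders differ at \<open>q\<close> exactly as the element counts
    do.\<close>
  ultimately obtain c where c: "card (torsion q :: 'g set) = ?N q + c" "card (torsion q :: 'h set) = ?M q + c"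
    unfolding card_torsion[OF \<open>0 < q\<close>] using \<open>0 < q\<close> by simp
  then have tors_less: "card (torsion q :: 'h set) < card (torsion q :: 'g set)" using less by simp
  have "q \<noteq> 1" using less by auto
  then obtain p where p: "prime p" "p dvd q" using prime_factor_nat by blast
  obtain r where r: "q = p ^ multiplicity p q * r" "\<not> p dvd r"
    using multiplicity_decompose'[of q p] p(1) \<open>0 < q\<close> by (metis not_prime_unit less_numeral_extra(3))
  define k where "k = multiplicity p q"
  have "k \<noteq> 0" using r p(2) unfolding k_def by (intro notI) simp
  then obtain i where i: "k = Suc i" by (cases k) auto
  have pk: "q = p ^ k * r" using r(1) by (simp add: k_def)
  \<comment> \<open>Otherwise \<open>q\<close> splits into two coprime proper divisors, at which the
    torsion orders agree, and multiplicativity makes them agree at \<open>q\<close>.\<close>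
  have "r = 1"
  proof (rule ccontr)
    assume "r \<noteq> 1"
    have "0 < r" using pk \<open>0 < q\<close> by (intro Nat.gr0I) simp
    have "1 < p ^ k" by (rule one_less_power[OF prime_gt_1_nat[OF p(1)]]) (use \<open>k \<noteq> 0\<close> in simp)
    have "p ^ k < q" "r < q" using pk \<open>r \<noteq> 1\<close> \<open>0 < r\<close> \<open>1 < p ^ k\<close> prime_gt_0_nat[OF p(1)] by auto
    moreover have "coprime (p ^ k) r" using p(1) r(2) by (simp add: prime_imp_coprime)
    moreover have "p ^ k dvd q" "r dvd q" using pk by auto
    ultimately show False
      using tors_less tors_eq[of "p ^ k"] tors_eq[of r]
        card_torsion_coprime[of "p ^ k" r, where 'g = 'g] card_torsion_coprime[of "p ^ k" r, where 'g = 'h]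
      by (simp flip: pk)
  qed
  then have qp: "q = p ^ Suc i" using pk i by simp
  have "card (torsion (p ^ i) :: 'g set) = card (torsion (p ^ i) :: 'h set)"
    by (rule tors_eq) (use prime_gt_1_nat[OF p(1)] in \<open>auto simp: qp\<close>)
  note diff = first_torsion_difference[OF trans[OF card(1) card(2)[symmetric]] p(1) qp this tors_less]
  have qn: "q * q dvd n" using diff(1) card by simp
  have Mq: "?M q + q \<le> ?N q" using diff(2) c by simp
  let ?D = "{d. d dvd n \<and> d dvd m}"
  have "finite ?D" using \<open>0 < n\<close> by simp
  then have fin: "finite {d \<in> ?D. d < q}" "finite {d \<in> ?D. q < d}"
    by (rule rev_finite_subset, blast)+
  have split: "(\<Sum>d\<in>?D. f d) = (\<Sum>d\<in>{d \<in> ?D. d < q}. f d) + f q + (\<Sum>d\<in>{d \<in> ?D. q < d}. f d)" for f :: "nat \<Rightarrow> nat"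
  proof -
    have D: "?D = {d \<in> ?D. d < q} \<union> ({q} \<union> {d \<in> ?D. q < d})" using q by auto
    have "(\<Sum>d\<in>?D. f d) = (\<Sum>d\<in>{d \<in> ?D. d < q}. f d) + (\<Sum>d\<in>{q} \<union> {d \<in> ?D. q < d}. f d)"
      by (subst D, rule sum.union_disjoint[OF fin(1) finite_UnI[OF _ fin(2)]]) auto
    also have "(\<Sum>d\<in>{q} \<union> {d \<in> ?D. q < d}. f d) = f q + (\<Sum>d\<in>{d \<in> ?D. q < d}. f d)"
      using fin(2) by (simp only: insert_is_Un[symmetric]) (subst sum.insert, auto)
    finally show ?thesis by simp
  qed
  have "n * (\<Sum>d\<in>{d \<in> ?D. q < d}. ?M d * W d) \<le> (\<Sum>d\<in>{d \<in> ?D. q < d}. ?M d * (q * W q))"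
    unfolding sum_distrib_left
  proof (rule sum_mono)
    fix d assume "d \<in> {d \<in> ?D. q < d}"
    then have "n * W d \<le> q * W q"
      unfolding W_def by (intro binomial_gap[OF p(1) qp qn \<open>0 < n\<close> \<open>n \<le> m\<close>]) (use q in auto)
    then show "n * (?M d * W d) \<le> ?M d * (q * W q)"
      by (metis mult.left_commute mult_le_mono2)
  qed
  also have "\<dots> = (\<Sum>d\<in>{d \<in> ?D. q < d}. ?M d) * (q * W q)"
    by (simp add: sum_distrib_right)
  also have "\<dots> < n * (q * W q)"
  proof (rule mult_strict_right_mono)
    have "n = card (torsion n :: 'h set)" by (simp add: torsion_def flip: card(2))
    also have "\<dots> = (\<Sum>d | d dvd n. ?M d)" by (rule card_torsion[OF \<open>0 < n\<close>])
    \<comment> \<open>Order 1 lies outside the range \<open>d > q\<close>; the zero element makes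
      the bound strict.\<close>
    also have "\<dots> \<ge> (\<Sum>d\<in>insert 1 {d \<in> ?D. q < d}. ?M d)"
      using \<open>0 < n\<close> by (intro sum_mono2) auto
    also have "(\<Sum>d\<in>insert 1 {d \<in> ?D. q < d}. ?M d) = 1 + (\<Sum>d\<in>{d \<in> ?D. q < d}. ?M d)"
      by (subst sum.insert) (use fin \<open>0 < q\<close> in auto)
    finally show "(\<Sum>d\<in>{d \<in> ?D. q < d}. ?M d) < n" by simp
    have "0 < n div q" using q(1) \<open>0 < n\<close> by (auto simp: div_greater_zero_iff dvd_imp_le \<open>0 < q\<close>)
    then show "0 < q * W q" using \<open>0 < q\<close> by (simp add: W_def)
  qed
  finally have "(\<Sum>d\<in>{d \<in> ?D. q < d}. ?M d * W d) < q * W q" by simp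
  moreover have "?M q * W q + q * W q \<le> ?N q * W q"
    using mult_right_mono[OF Mq, of "W q"] by (simp add: distrib_right)
  moreover have "(\<Sum>d\<in>{d \<in> ?D. d < q}. ?N d * W d) = (\<Sum>d\<in>{d \<in> ?D. d < q}. ?M d * W d)"
    by (rule sum.cong) (auto simp: eq)
  moreover note sums[folded W_def, unfolded split[of "\<lambda>d. ?N d * W d"] split[of "\<lambda>d. ?M d * W d"]]
  ultimately show False by linarith
qed

lemma zero_sum_count:
  "CARD('g) * card {a \<in> compositions m. weighted_sum a = (0 :: 'g::{ab_group_add,finite})}
    = (\<Sum>d | d dvd CARD('g) \<and> d dvd m. card (elements_of_order d :: 'g set) *
        ((CARD('g) div d + m div d - 1) choose (m div d)))" (is "?n * _ = _")
proof -
  have "real (?n * card {a \<in> compositions m. weighted_sum a = (0 :: 'g)})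
      = (\<Sum>d | d dvd ?n \<and> d dvd m. real (card (elements_of_order d :: 'g set)) * torsion_weight ?n 1 d m)"
    using zero_sum_weight[where u = 1 and m = m and 'g = 'g] by simp
  also have "\<dots> = (\<Sum>d | d dvd ?n \<and> d dvd m. real (card (elements_of_order d :: 'g set) *
        ((?n div d + m div d - 1) choose (m div d))))"
  proof (rule sum.cong)
    fix d assume d: "d \<in> {d. d dvd ?n \<and> d dvd m}"
    obtain a where a: "?n = d * a" using d by auto
    obtain b where b: "m = d * b" using d by auto
    note ab = a b
    then have "0 < a" "0 < d" by (auto intro!: Nat.gr0I)
    then have "torsion_weight ?n 1 d m = real ((a + b - 1) choose b)"
      "?n div d = a" "m div d = b"
      using torsion_weight_one[of a d b] ab by auto
    then show "real (card (elements_of_order d :: 'g set)) * torsion_weight ?n 1 d m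
      = real (card (elements_of_order d :: 'g set) * ((?n div d + m div d - 1) choose (m div d)))" by simp
  qed simp
  finally show ?thesis by (simp only: of_nat_eq_iff flip: of_nat_sum)
qed

text \<open>Strong induction on \<open>d\<close> supplies the agreement below \<open>d\<close>; the
  two directions of a difference are excluded by exchanging the groups.\<close>

lemma elements_of_order_eq:
  fixes m n d :: nat
  assumes card: "CARD('g::{ab_group_add,finite}) = n" "CARD('h::{ab_group_add,finite}) = n"
    and "n \<le> m"
    and eq: "card {a \<in> compositions m. weighted_sum a = (0 :: 'g)}
      = card {a \<in> compositions m. weighted_sum a = (0 :: 'h)}"
    and "d dvd n" "d dvd m"
  shows "card (elements_of_order d :: 'g set) = card (elements_of_order d :: 'h set)"
  using assms(5,6)
proof (induction d rule: less_induct)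
  case (less d)
  note sums = zero_sum_count[of m, where 'g = 'g] zero_sum_count[of m, where 'g = 'h]
  show ?case
  proof (rule ccontr)
    assume "\<not> ?thesis"
    then consider "card (elements_of_order d :: 'h set) < card (elements_of_order d :: 'g set)"
      | "card (elements_of_order d :: 'g set) < card (elements_of_order d :: 'h set)" by linarith
    then show False
    proof cases
      case 1
      show False
        by (rule no_first_difference[OF card \<open>n \<le> m\<close> less.prems less.IH 1])
          (use sums eq card in auto)
    next
      case 2
      show False
        by (rule no_first_difference[OF card(2,1) \<open>n \<le> m\<close> less.prems less.IH[symmetric] 2])
          (use sums eq card in auto)
    qed
  qed
qed

section \<open>From element counts to the distribution of support sizes\<close>

lemma supp_card_polynomial:
  fixes u :: real
  shows "(\<Sum>a | a \<in> compositions m \<and> weighted_sum a = (0 :: 'g::{ab_group_add,finite}). u ^ supp_card a)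
    = (\<Sum>k\<le>CARD('g). real (card {a \<in> compositions m. weighted_sum a = (0 :: 'g) \<and> supp_card a = k}) * u ^ k)"
proof -
  let ?A = "{a \<in> compositions m. weighted_sum a = (0 :: 'g)}"
  have "(\<Sum>a\<in>?A. u ^ supp_card a) = (\<Sum>k\<le>CARD('g). \<Sum>a\<in>{a \<in> ?A. supp_card a = k}. u ^ supp_card a)"
    by (rule sum.group[symmetric]) (auto simp: supp_card_def intro!: card_mono)
  then show ?thesis by (simp add: conj_assoc)
qed

text \<open>By \<open>zero_sum_weight\<close> the weighted sums agree for every real
  \<open>u\<close>, so the polynomials in \<open>u\<close> have equal coefficients. Beyond
  \<open>k = n\<close> both sides are 0.\<close>

lemma supp_card_count_eq:
  assumes card: "CARD('g::{ab_group_add,finite}) = n" "CARD('h::{ab_group_add,finite}) = n"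
    and "n \<le> m"
    and eq: "card {a \<in> compositions m. weighted_sum a = (0 :: 'g)}
      = card {a \<in> compositions m. weighted_sum a = (0 :: 'h)}"
  shows "card {a \<in> compositions m. weighted_sum a = (0 :: 'g) \<and> supp_card a = k}
      = card {a \<in> compositions m. weighted_sum a = (0 :: 'h) \<and> supp_card a = k}"
proof (cases "k \<le> n")
  case True
  have "(\<Sum>a | a \<in> compositions m \<and> weighted_sum a = (0 :: 'g). u ^ supp_card a)
      = (\<Sum>a | a \<in> compositions m \<and> weighted_sum a = (0 :: 'h). u ^ supp_card a)" for u :: real
  proof -
    have "real n * (\<Sum>a | a \<in> compositions m \<and> weighted_sum a = (0 :: 'g). u ^ supp_card a)
      = real n * (\<Sum>a | a \<in> compositions m \<and> weighted_sum a = (0 :: 'h). u ^ supp_card a)"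
      unfolding zero_sum_weight[where m = m and u = u and 'g = 'g, unfolded card]
        zero_sum_weight[where m = m and u = u and 'g = 'h, unfolded card]
      by (rule sum.cong) (auto simp: elements_of_order_eq[OF card \<open>n \<le> m\<close> eq])
    moreover have "0 < n" unfolding card(1)[symmetric] by simp
    ultimately show ?thesis by simp
  qed
  then have "\<forall>u::real. (\<Sum>k\<le>n. real (card {a \<in> compositions m. weighted_sum a = (0 :: 'g) \<and> supp_card a = k}) * u ^ k)
      = (\<Sum>k\<le>n. real (card {a \<in> compositions m. weighted_sum a = (0 :: 'h) \<and> supp_card a = k}) * u ^ k)"
    using supp_card_polynomial[where m = m and 'g = 'g] supp_card_polynomial[where m = m and 'g = 'h] card by simp
  then show ?thesis using True unfolding polyfun_eq_coeffs by auto
next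
  case False
  then have "supp_card a \<noteq> k" for a :: "'g \<Rightarrow> nat"
    using card(1) card_mono[of UNIV "{g. a g \<noteq> 0}"] by (auto simp: supp_card_def)
  moreover have "supp_card a \<noteq> k" for a :: "'h \<Rightarrow> nat"
    using False card(2) card_mono[of UNIV "{g. a g \<noteq> 0}"] by (auto simp: supp_card_def)
  ultimately show ?thesis by simp
qed

section \<open>Lattice points in open faces\<close>

lemma sum_axis_component:
  fixes u :: "real ^ 'g \<Rightarrow> real"
  shows "(\<Sum>x\<in>(\<lambda>g. axis g 1) ` S. u x *\<^sub>R x) $ h = (if h \<in> S then u (axis h 1) else 0)"
proof -
  have inj: "inj_on (\<lambda>g. axis g (1::real)) S" by (auto simp: inj_on_def axis_eq_axis)
  have component: "axis g (1::real) $ h = (if h = g then 1 else 0)" for g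
    by (simp add: axis_def)
  have "(\<Sum>x\<in>(\<lambda>g. axis g 1) ` S. u x *\<^sub>R x) $ h = (\<Sum>g\<in>S. if h = g then u (axis g 1) else 0)"
    using inj by (simp add: sum.reindex component if_distrib[of "(*) _"] cong: if_cong)
  then show ?thesis by simp
qed

text \<open>The predicate \<open>P\<close> lets one computation serve both the convex hull
  (\<open>P\<close> nonnegative) and its relative interior (\<open>P\<close> positive).\<close>

lemma combinations_of_axes:
  "{y :: real ^ 'g. \<exists>u. (\<forall>x\<in>(\<lambda>g. axis g 1) ` S. P (u x)) \<and> sum u ((\<lambda>g. axis g 1) ` S) = 1 \<and>
      (\<Sum>x\<in>(\<lambda>g. axis g 1) ` S. u x *\<^sub>R x) = y}
    = {y. (\<forall>g. if g \<in> S then P (y $ g) else y $ g = 0) \<and> (\<Sum>g\<in>UNIV. y $ g) = 1}"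
proof (intro equalityI subsetI)
  let ?e = "\<lambda>g :: 'g. axis g (1::real)"
  have inj: "inj_on ?e S" by (auto simp: inj_on_def axis_eq_axis)
  fix y :: "real ^ 'g"
  {
    assume "y \<in> {y. \<exists>u. (\<forall>x\<in>?e ` S. P (u x)) \<and> sum u (?e ` S) = 1 \<and> (\<Sum>x\<in>?e ` S. u x *\<^sub>R x) = y}"
    then obtain u where u: "\<forall>x\<in>?e ` S. P (u x)" "sum u (?e ` S) = 1" "(\<Sum>x\<in>?e ` S. u x *\<^sub>R x) = y"
      by blast
    have y: "y $ g = (if g \<in> S then u (?e g) else 0)" for g
      unfolding u(3)[symmetric] by (rule sum_axis_component)
    have "(\<Sum>g\<in>UNIV. y $ g) = (\<Sum>g\<in>S. u (?e g))"
      by (rule sum.mono_neutral_cong_right) (auto simp: y)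
    then show "y \<in> {y. (\<forall>g. if g \<in> S then P (y $ g) else y $ g = 0) \<and> (\<Sum>g\<in>UNIV. y $ g) = 1}"
      using u(1,2) by (auto simp: y sum.reindex[OF inj])
  next
    assume y: "y \<in> {y. (\<forall>g. if g \<in> S then P (y $ g) else y $ g = 0) \<and> (\<Sum>g\<in>UNIV. y $ g) = 1}"
    define u where "u x = y $ (THE g. x = ?e g)" for x
    have u: "u (?e g) = y $ g" for g
      unfolding u_def by (auto simp: axis_eq_axis)
    have "(\<Sum>g\<in>S. y $ g) = (\<Sum>g\<in>UNIV. y $ g)"
      by (rule sum.mono_neutral_left) (use y in auto)
    then have "sum u (?e ` S) = 1"
      using y by (simp add: sum.reindex[OF inj] u)
    moreover have "(\<Sum>x\<in>?e ` S. u x *\<^sub>R x) = y"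
      unfolding vec_eq_iff sum_axis_component u using y by auto
    moreover have "\<forall>x\<in>?e ` S. P (u x)" using y u by (auto split: if_splits)
    ultimately show "y \<in> {y. \<exists>u. (\<forall>x\<in>?e ` S. P (u x)) \<and> sum u (?e ` S) = 1 \<and> (\<Sum>x\<in>?e ` S. u x *\<^sub>R x) = y}"
      by blast
  }
qed

text \<open>Faces of the standard simplex are indexed by sets of group elements, so that the support
  of a point names its open face. The empty set gives the empty face.\<close>

definition axes_hull :: "'g::finite set \<Rightarrow> (real ^ 'g) set" where
  "axes_hull S = convex hull ((\<lambda>g. axis g 1) ` S)"

lemma affine_independent_axes:
  "\<not> affine_dependent ((\<lambda>g. axis g 1 :: real ^ 'g) ` S)"
proof -
  have "(\<lambda>g. axis g 1 :: real ^ 'g) ` S \<subseteq> Basis" by (auto simp: Basis_vec_def)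
  then show ?thesis
    using independent_Basis independent_mono affine_dependent_imp_dependent by blast
qed

lemma axes_hull_eq:
  "axes_hull S = {y :: real ^ 'g. (\<forall>g. if g \<in> S then 0 \<le> y $ g else y $ g = 0) \<and> (\<Sum>g\<in>UNIV. y $ g) = 1}"
  unfolding combinations_of_axes[symmetric] axes_hull_def by (rule convex_hull_finite) simp

lemma rel_interior_axes_hull:
  "rel_interior (axes_hull S)
    = {y :: real ^ 'g. (\<forall>g. if g \<in> S then 0 < y $ g else y $ g = 0) \<and> (\<Sum>g\<in>UNIV. y $ g) = 1}"
  unfolding combinations_of_axes[symmetric] axes_hull_def
  by (rule rel_interior_convex_hull_explicit) (rule affine_independent_axes)

lemma zero_sum_simplex_eq: "zero_sum_simplex = axes_hull UNIV"
  by (simp add: axes_hull_eq zero_sum_simplex_def)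

lemma aff_dim_axes_hull: "aff_dim (axes_hull (S :: 'g::finite set)) = int (card S) - 1"
proof -
  have "card ((\<lambda>g. axis g 1 :: real ^ 'g) ` S) = card S"
    by (rule card_image) (auto simp: inj_on_def axis_eq_axis)
  then show ?thesis
    using aff_dim_affine_independent[OF affine_independent_axes[of S]]
    by (simp add: axes_hull_def aff_dim_convex_hull)
qed

lemma inj_axes_hull: "inj axes_hull"
proof (rule injI)
  have "g \<in> S \<longleftrightarrow> axis g 1 \<in> axes_hull S" for g :: 'a and S
    by (auto simp: axes_hull_eq axis_def)
  then show "S = S'" if "axes_hull S = axes_hull S'" for S S' :: "'a set" using that by blast
qed

text \<open>The vertices are affinely independent, so every subset of them spans a face, and an
  injective linear map preserves faces and dimensions. As \<open>k\<close> is natural, the empty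
  face of dimension -1 never occurs.\<close>

lemma faces_zero_sum_polytope:
  fixes T :: "real ^ 'g::{ab_group_add, finite} \<Rightarrow> real ^ 'n::finite"
  assumes "lattice_iso T"
  shows "{F. F face_of zero_sum_polytope T \<and> aff_dim F = int k}
    = (\<lambda>S. T ` axes_hull S) ` {S. card S = Suc k}"
proof -
  have T: "linear T" "inj T" using assms by (auto simp: lattice_iso_def bij_def)
  have faces: "F face_of zero_sum_simplex \<longleftrightarrow> (\<exists>S. F = axes_hull S)" for F :: "(real, 'g) vec set"
    unfolding zero_sum_simplex_eq axes_hull_def face_of_convex_hull_affine_independent[OF affine_independent_axes]
    by (metis subset_image_iff subset_UNIV)
  have dim: "aff_dim (T ` axes_hull S) = int k \<longleftrightarrow> card S = Suc k" for S
    using T by (auto simp: aff_dim_injective_linear_image aff_dim_axes_hull)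
  have "{F. F face_of zero_sum_polytope T} = (\<lambda>S. T ` axes_hull S) ` UNIV"
    unfolding zero_sum_polytope_def faces_of_linear_image[OF T] using faces by auto
  then have "{F. F face_of zero_sum_polytope T \<and> aff_dim F = int k}
      = {F \<in> (\<lambda>S. T ` axes_hull S) ` UNIV. aff_dim F = int k}" by blast
  then show ?thesis using dim by auto
qed

text \<open>\<open>R\<close> describes the shape of the open or closed face; it has to define a cone.\<close>

lemma card_lattice_points:
  fixes T :: "real ^ 'g::{ab_group_add, finite} \<Rightarrow> real ^ 'n::finite"
  assumes "lattice_iso T" "0 < m"
    and R: "\<And>g t. R g (real m * t) \<longleftrightarrow> R g t" "\<And>g t. R g t \<Longrightarrow> 0 \<le> t"
  shows "card (dilate m (T ` {y. (\<forall>g. R g (y $ g)) \<and> (\<Sum>g\<in>UNIV. y $ g) = 1}) \<inter> integer_points)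
    = card {a \<in> compositions m. weighted_sum a = (0::'g) \<and> (\<forall>g. R g (real (a g)))}"
proof -
  let ?Q = "{y :: (real, 'g) vec. (\<forall>g. R g (y $ g)) \<and> (\<Sum>g\<in>UNIV. y $ g) = 1}"
  let ?A = "{a \<in> compositions m. weighted_sum a = (0::'g) \<and> (\<forall>g. R g (real (a g)))}"
  let ?v = "\<lambda>a :: 'g \<Rightarrow> nat. \<chi> g. real (a g)"
  have T: "linear T" "inj T" "T ` zero_sum_lattice = integer_points"
    using assms by (auto simp: lattice_iso_def bij_def)
  \<comment> \<open>\<open>T\<close> commutes with dilation and carries one lattice onto the other,
    so the count can be made in the original coordinates.\<close>
  have "dilate m (T ` ?Q) \<inter> integer_points = T ` (dilate m ?Q \<inter> zero_sum_lattice)"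
    unfolding T(3)[symmetric] dilate_def image_Int[OF T(2)]
    by (simp add: image_image linear_scale[OF T(1)])
  also have "dilate m ?Q \<inter> zero_sum_lattice = ?v ` ?A"
  proof (intro equalityI subsetI)
    fix x assume "x \<in> dilate m ?Q \<inter> zero_sum_lattice"
    then have "x \<in> dilate m ?Q" "x \<in> zero_sum_lattice" by auto
    then obtain y b where y: "x = real m *\<^sub>R y" "y \<in> ?Q"
      and b: "x = (\<chi> g. of_int (b g))" "(\<Sum>g\<in>UNIV. int_scale (b g) g) = 0"
      unfolding dilate_def zero_sum_lattice_def by blast
    have xb: "real m * y $ g = of_int (b g)" for g
      using y(1) b(1) by (simp add: vec_eq_iff)
    have Rb: "R g (of_int (b g))" for g using y(2) R(1)[of g "y $ g"] by (simp add: xb)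
    then have "0 \<le> b g" for g using R(2) of_int_0_le_iff by blast
    then have bn: "int (nat (b g)) = b g" "real (nat (b g)) = of_int (b g)" for g by simp_all
    have "real (sum (\<lambda>g. nat (b g)) UNIV) = (\<Sum>g\<in>UNIV. real m * y $ g)"
      by (simp add: bn xb)
    also have "\<dots> = real m" using y(2) by (simp flip: sum_distrib_left)
    finally have "(\<lambda>g. nat (b g)) \<in> compositions m"
      by (simp only: compositions_def mem_Collect_eq of_nat_eq_iff)
    then have "(\<lambda>g. nat (b g)) \<in> ?A"
      using b(2) Rb by (simp add: weighted_sum_def bn del: int_nat_eq)
    then show "x \<in> ?v ` ?A"
      by (rule image_eqI[rotated]) (simp add: b(1) bn del: of_nat_nat)
  next
    fix x assume "x \<in> ?v ` ?A"
    then obtain a where a: "x = ?v a" "a \<in> ?A" by blast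
    define y :: "(real, 'g) vec" where "y = (\<chi> g. real (a g) / real m)"
    have "(\<Sum>g\<in>UNIV. y $ g) = real (sum a UNIV) / real m"
      by (simp add: y_def sum_divide_distrib)
    then have "(\<Sum>g\<in>UNIV. y $ g) = 1" using a(2) \<open>0 < m\<close>
      by (simp add: compositions_def flip: of_nat_sum)
    moreover have "R g (y $ g)" for g
      using a(2) R(1)[of g "y $ g"] \<open>0 < m\<close> by (simp add: y_def)
    moreover have "x = real m *\<^sub>R y" using \<open>0 < m\<close> by (simp add: a(1) y_def vec_eq_iff)
    ultimately have "x \<in> dilate m ?Q" by (auto simp: dilate_def)
    moreover have "x \<in> zero_sum_lattice"
      using a unfolding zero_sum_lattice_def weighted_sum_def
      by (intro CollectI exI[of _ "\<lambda>g. int (a g)"]) auto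
    ultimately show "x \<in> dilate m ?Q \<inter> zero_sum_lattice" by blast
  qed
  finally have *: "dilate m (T ` ?Q) \<inter> integer_points = T ` ?v ` ?A" .
  have "inj_on ?v ?A" by (auto simp: inj_on_def vec_eq_iff)
  then show ?thesis
    unfolding * by (simp add: card_image inj_on_subset[OF T(2)])
qed

lemma card_points_polytope:
  assumes "lattice_iso (T :: real ^ 'g::{ab_group_add, finite} \<Rightarrow> real ^ 'n::finite)" "0 < m"
  shows "card (dilate m (zero_sum_polytope T) \<inter> integer_points)
    = card {a \<in> compositions m. weighted_sum a = (0::'g)}"
  using card_lattice_points[OF assms, of "\<lambda>g t. 0 \<le> t"] assms(2)
  by (simp add: zero_sum_polytope_def zero_sum_simplex_def zero_le_mult_iff)

text \<open>Relative interiors commute with \<open>T\<close>, and a point of the open face is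
  positive exactly on \<open>S\<close>.\<close>

lemma card_points_open_face:
  assumes "lattice_iso (T :: real ^ 'g::{ab_group_add, finite} \<Rightarrow> real ^ 'n::finite)" "0 < m"
  shows "card (dilate m (rel_interior (T ` axes_hull S)) \<inter> integer_points)
    = card {a \<in> compositions m. weighted_sum a = (0::'g) \<and> {g. a g \<noteq> 0} = S}"
proof -
  have T: "bounded_linear T" "inj T"
    using assms by (auto simp: lattice_iso_def bij_def linear_conv_bounded_linear)
  have supp: "(\<forall>g. if g \<in> S then 0 < real (a g) else real (a g) = 0) \<longleftrightarrow> {g. a g \<noteq> 0} = S" for a :: "'g \<Rightarrow> nat"
    unfolding set_eq_iff mem_Collect_eq by (intro iff_allI) auto
  show ?thesis
    using card_lattice_points[OF assms, of "\<lambda>g t. if g \<in> S then 0 < t else t = 0"] assms(2)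
    unfolding rel_interior_injective_linear_image[OF T] rel_interior_axes_hull supp
    by (simp add: zero_less_mult_iff split: if_splits)
qed

lemma sum_points_open_faces:
  assumes "lattice_iso (T :: real ^ 'g::{ab_group_add, finite} \<Rightarrow> real ^ 'n::finite)" "0 < m"
  shows "(\<Sum>F | F face_of zero_sum_polytope T \<and> aff_dim F = int k.
        card (dilate m (rel_interior F) \<inter> integer_points))
    = card {a \<in> compositions m. weighted_sum a = (0::'g) \<and> supp_card a = Suc k}"
proof -
  have "inj T" using assms by (auto simp: lattice_iso_def bij_def)
  \<comment> \<open>Distinct index sets give distinct faces, so the sum over faces becomes a sum
    over supports of size \<open>Suc k\<close>.\<close>
  then have inj: "inj_on (\<lambda>S. T ` axes_hull S) {S. card S = Suc k}"
    using inj_axes_hull by (auto simp: inj_on_def inj_image_eq_iff)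
  have "{a \<in> compositions m. weighted_sum a = (0::'g) \<and> supp_card a = Suc k}
      = (\<Union>S\<in>{S. card S = Suc k}. {a \<in> compositions m. weighted_sum a = (0::'g) \<and> {g. a g \<noteq> 0} = S})"
    by (auto simp: supp_card_def)
  also have "card \<dots> = (\<Sum>S | card S = Suc k. card {a \<in> compositions m. weighted_sum a = (0::'g) \<and> {g. a g \<noteq> 0} = S})"
    by (rule card_UN_disjoint) auto
  finally show ?thesis
    unfolding faces_zero_sum_polytope[OF assms(1)] sum.reindex[OF inj] o_def
      card_points_open_face[OF assms] by simp
qed

lemma card_points_interior:
  assumes "lattice_iso (T :: real ^ 'g::{ab_group_add, finite} \<Rightarrow> real ^ 'n::finite)" "0 < m"
  shows "card (dilate m (rel_interior (zero_sum_polytope T)) \<inter> integer_points)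
    = card {a \<in> compositions m. weighted_sum a = (0::'g) \<and> supp_card a = CARD('g)}"
proof -
  have "supp_card a = CARD('g) \<longleftrightarrow> {g. a g \<noteq> 0} = UNIV" for a :: "'g \<Rightarrow> nat"
    unfolding supp_card_def by (metis card_subset_eq finite subset_UNIV)
  then show ?thesis
    using card_points_open_face[OF assms, of UNIV]
    by (simp add: zero_sum_polytope_def zero_sum_simplex_eq)
qed

theorem theorem1p2:
  fixes T\<^sub>G :: "real ^ 'g::{ab_group_add, finite} \<Rightarrow> real ^ 'n::finite"
    and T\<^sub>H :: "real ^ 'h::{ab_group_add, finite} \<Rightarrow> real ^ 'n"
    and n m :: nat
  assumes "CARD('g) = n" and "CARD('h) = n" and "CARD('n) = n"
    and "lattice_iso T\<^sub>G" and "lattice_iso T\<^sub>H"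
    and "0 < m" and "n \<le> m"
    and "card (dilate m (zero_sum_polytope T\<^sub>G) \<inter> integer_points)
       = card (dilate m (zero_sum_polytope T\<^sub>H) \<inter> integer_points)"
  shows "card (dilate m (rel_interior (zero_sum_polytope T\<^sub>G)) \<inter> integer_points)
       = card (dilate m (rel_interior (zero_sum_polytope T\<^sub>H)) \<inter> integer_points)
    \<and> (\<forall>k::nat. k \<le> n - 1 \<longrightarrow>
        (\<Sum>F | F face_of zero_sum_polytope T\<^sub>G \<and> aff_dim F = int k.
            card (dilate m (rel_interior F) \<inter> integer_points))
      = (\<Sum>F | F face_of zero_sum_polytope T\<^sub>H \<and> aff_dim F = int k.
            card (dilate m (rel_interior F) \<inter> integer_points)))"
proof -
  note card = assms(1,2) and iso = assms(4,5) and m = assms(6)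
  have "card {a \<in> compositions m. weighted_sum a = (0 :: 'g)}
      = card {a \<in> compositions m. weighted_sum a = (0 :: 'h)}"
    using assms(8) by (simp only: card_points_polytope[OF iso(1) m] card_points_polytope[OF iso(2) m])
  \<comment> \<open>This holds for every support size: \<open>n\<close> gives the interior, and
    \<open>Suc k\<close> gives the faces of dimension \<open>k\<close>.\<close>
  note eq = supp_card_count_eq[OF card assms(7) this]
  show ?thesis
    unfolding card_points_interior[OF iso(1) m] card_points_interior[OF iso(2) m]
      sum_points_open_faces[OF iso(1) m] sum_points_open_faces[OF iso(2) m] card
    by (simp only: eq simp_thms)
qed

end
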